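(* Assume $A$ is associative. Let $\Omega$ be a domain in $V$ and let $f:\Omega\to A$ be $T$-regular. Fix $J\in\mathbb{T}$, a point $p\in\Omega_J$ and a radius $R>0$ such that $\overline{B}(p,R)_J\subset\Omega_J$. Then \[f(p)=\frac{1}{\sigma_{t_0+\tau}}\int_{\partial B_J}f_J(p+Rw)\,|do_w|,\] where $B:=B(0,1)$, so that $\partial B_J=\{w\in\mathbb{R}_J^{t_0+\tau+1}:\|w\|=1\}$, and $|do_w|$ denotes the surface element of the unit sphere $\partial B_J$.
   Context: $\mathbb{N}$ includes $0$. $A$ is a finite-dimensional alternative (unital) real $*$-algebra: a finite-dimensional real vector space with an $\mathbb{R}$-bilinear multiplication such that $x(xy)=x^2y$, $(xy)y=xy^2$ (automatic if $A$ is associative), and with an involutive real-linear antiautomorphism $x\mapsto x^c$; $\mathbb{R}$ is identified with $\mathbb{R}1$. Set $t(x)=x+x^c$, $n(x)=xx^c$, $\mathbb{S}_A=\{x\in A:t(x)=0,\ n(x)=1\}$, assumed nonempty. Let $Q_A=\bigcup_{J\in\mathbb{S}_A}(\mathbb{R}+J\mathbb{R})$. A hypercomplex subspace of $A$ is a real vector subspace $V$ with $\mathbb{R}\subsetneq V\subseteq Q_A$; a hypercomplex basis of $V$ is an ordered real basis $(v_0,\ldots,v_n)$ with $n\ge1$, $v_0=1$, $v_s\in\mathbb{S}_A$ and $v_sv_u=-v_uv_s$ for distinct $s,u\in\{1,\ldots,n\}$. Setting. $V$ is a hypercomplex subspace of $A$ with hypercomplex basis $\mathcal{B}=(v_0,\ldots,v_n)$,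 completed to a real basis $\mathcal{B}'=(v_0,\ldots,v_d)$ of $A$; $\langle\cdot,\cdot\rangle$ and $\|\cdot\|$ are the Euclidean scalar product and norm on $A$ making $\mathcal{B}'$ orthonormal. A domain is a nonempty connected open subset. For $p\in V$, $R>0$: $B(p,R)=\{x\in V:\|x-p\|<R\}$, $\overline{B}(p,R)=\{x\in V:\|x-p\|\le R\}$. Fix $\tau\in\{0,\ldots,n\}$ and a list of steps $T=(t_0,\ldots,t_\tau)\in\mathbb{N}^{\tau+1}$ with $0\le t_0<t_1<\cdots<t_\tau=n$. For $0\le\ell\le m\le n$, $\mathbb{R}_{\ell,m}=\mathrm{Span}(v_\ell,\ldots,v_m)$ and $\mathbb{S}_{\ell,m}$ is its unit sphere. The $T$-torus is $\mathbb{T}=\mathbb{S}_{t_0+1,t_1}\times\cdots\times\mathbb{S}_{t_{\tau-1}+1,t_\tau}$ if $\tau\ge1$. For $J=(J_1,\ldots,J_\tau)\in\mathbb{T}$, $\mathcal{B}_J=(v_0,v_1,\ldots,v_{t_0},J_1,\ldots,J_\tau)$ and $\mathbb{R}_J^{t_0+\tau+1}=\mathrm{Span}(\mathcal{B}_J)$, with elements written $x_0+v_1x_1+\cdots+v_{t_0}x_{t_0}+\beta_1J_1+\cdots+\beta_\tau J_\tau$. If $\tau=0$, "$J\in\mathbb{T}$" is read as $J=\emptyset$, with $\mathcal{B}_\emptyset=\mathcal{B}$ and $\mathbb{R}_\emptyset^{t_0+1}=V$. For $Y\subseteq V$ and $f:Y\to A$: $Y_J=Y\cap\mathbb{R}_J^{t_0+\tau+1}$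 and $f_J=f|_{Y_J}$. A function $f:\Omega\to A$ on a domain $\Omega\subseteq V$ is $T$-regular if for every $J\in\mathbb{T}$ the restriction $f_J$ is $J$-monogenic, i.e. of class $\mathscr{C}^1$ on the open subset $\Omega_J$ of $\mathbb{R}_J^{t_0+\tau+1}$ with $(\partial_{x_0}+v_1\partial_{x_1}+\cdots+v_{t_0}\partial_{x_{t_0}}+J_1\partial_{\beta_1}+\cdots+J_\tau\partial_{\beta_\tau})f_J\equiv0$ (vacuous if $\Omega_J=\emptyset$). $\sigma_m:=2\,\Gamma(\tfrac12)^{m+1}/\Gamma(\tfrac{m+1}{2})$ is the surface volume of the unit $m$-sphere in $\mathbb{R}^{m+1}$. Integrals of $A$-valued functions are computed componentwise. *)

theory Defs
  imports "HOL-Analysis.Analysis"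
begin

text \<open>
  The associative real algebra is a type of sort \<open>{euclidean_space, real_algebra_1}\<close>: the sort
  provides finite dimension and a Euclidean scalar product. No compatibility between that scalar
  product and the multiplication is implied; below it is only required to make a given
  real basis orthonormal.
\<close>

definition star_involution :: "('a::real_algebra_1 \<Rightarrow> 'a) \<Rightarrow> bool" where
  "star_involution c \<longleftrightarrow>
     linear c \<and> (\<forall>x. c (c x) = x) \<and> (\<forall>x y. c (x * y) = c y * c x)"

definition trace_of :: "('a::real_algebra_1 \<Rightarrow> 'a) \<Rightarrow> 'a \<Rightarrow> 'a" where
  "trace_of c x = x + c x"

definition norm_of :: "('a::real_algebra_1 \<Rightarrow> 'a) \<Rightarrow> 'a \<Rightarrow> 'a" where
  "norm_of c x = x * c x"

definition imag_units :: "('a::real_algebra_1 \<Rightarrow> 'a) \<Rightarrow> 'a set" where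
  "imag_units c = {x. trace_of c x = 0 \<and> norm_of c x = 1}"

definition quadratic_cone :: "('a::real_algebra_1 \<Rightarrow> 'a) \<Rightarrow> 'a set" where
  "quadratic_cone c = (\<Union>J\<in>imag_units c. {of_real a + b *\<^sub>R J | a b. True})"

definition hypercomplex_subspace :: "('a::real_algebra_1 \<Rightarrow> 'a) \<Rightarrow> 'a set \<Rightarrow> bool" where
  "hypercomplex_subspace c V \<longleftrightarrow> subspace V \<and> range of_real \<subset> V \<and> V \<subseteq> quadratic_cone c"

definition ordered_basis :: "nat \<Rightarrow> (nat \<Rightarrow> 'a::real_vector) \<Rightarrow> 'a set \<Rightarrow> bool" where
  "ordered_basis n v V \<longleftrightarrow> inj_on v {0..n} \<and> independent (v ` {0..n}) \<and> span (v ` {0..n}) = V"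

definition hypercomplex_basis ::
    "('a::real_algebra_1 \<Rightarrow> 'a) \<Rightarrow> 'a set \<Rightarrow> nat \<Rightarrow> (nat \<Rightarrow> 'a) \<Rightarrow> bool" where
  "hypercomplex_basis c V n v \<longleftrightarrow>
     n \<ge> 1 \<and> ordered_basis n v V \<and> v 0 = 1 \<and>
     (\<forall>s\<in>{1..n}. v s \<in> imag_units c) \<and>
     (\<forall>s\<in>{1..n}. \<forall>u\<in>{1..n}. s \<noteq> u \<longrightarrow> v s * v u = - (v u * v s))"

definition orthonormal_family :: "nat \<Rightarrow> (nat \<Rightarrow> 'a::real_inner) \<Rightarrow> bool" where
  "orthonormal_family d v \<longleftrightarrow> (\<forall>i\<le>d. \<forall>j\<le>d. v i \<bullet> v j = (if i = j then 1 else 0))"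

definition domain_in :: "'a::topological_space set \<Rightarrow> 'a set \<Rightarrow> bool" where
  "domain_in V \<Omega> \<longleftrightarrow> openin (top_of_set V) \<Omega> \<and> \<Omega> \<noteq> {} \<and> connected \<Omega>"

definition list_of_steps :: "nat \<Rightarrow> nat \<Rightarrow> nat list \<Rightarrow> bool" where
  "list_of_steps n \<tau> T \<longleftrightarrow>
     \<tau> \<le> n \<and> length T = \<tau> + 1 \<and> sorted_wrt (<) T \<and> T ! \<tau> = n"

definition unit_sphere_span :: "(nat \<Rightarrow> 'a::real_inner) \<Rightarrow> nat \<Rightarrow> nat \<Rightarrow> 'a set" where
  "unit_sphere_span v l m = {x \<in> span (v ` {l..m}). norm x = 1}"

text \<open>
  A point \<open>(J\<^sub>1, \<dots>, J\<^sub>\<tau>)\<close> is a list, with \<open>J\<^sub>h\<close> at position \<open>h - 1\<close>. For \<open>\<tau> = 0\<close> the torus is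
  \<open>{[]}\<close>, and the slice basis and the slice of \<open>[]\<close> are the hypercomplex basis and the
  whole hypercomplex subspace.
\<close>

definition torus :: "(nat \<Rightarrow> 'a::real_inner) \<Rightarrow> nat list \<Rightarrow> 'a list set" where
  "torus v T =
     {J. length J + 1 = length T \<and>
         (\<forall>h<length J. J ! h \<in> unit_sphere_span v (T ! h + 1) (T ! (h + 1)))}"

definition slice_basis :: "(nat \<Rightarrow> 'a) \<Rightarrow> nat list \<Rightarrow> 'a list \<Rightarrow> 'a list" where
  "slice_basis v T J = map v [0..<T ! 0 + 1] @ J"

definition slice :: "(nat \<Rightarrow> 'a::real_vector) \<Rightarrow> nat list \<Rightarrow> 'a list \<Rightarrow> 'a set" where
  "slice v T J = span (set (slice_basis v T J))"

definition partial_deriv ::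
    "'a::real_normed_vector \<Rightarrow> ('a \<Rightarrow> 'b::real_normed_vector) \<Rightarrow> 'a \<Rightarrow> 'b" where
  "partial_deriv b f x = vector_derivative (\<lambda>h. f (x + h *\<^sub>R b)) (at 0)"

text \<open>
  Here \<open>U\<close> is meant to be relatively open in the subspace \<open>W\<close>. Only the restriction of \<open>D x\<close> to
  \<open>W\<close> is then determined, so continuity is demanded in the directions of \<open>W\<close> only.
\<close>

definition C1_on ::
    "'a::euclidean_space set \<Rightarrow> 'a set \<Rightarrow> ('a \<Rightarrow> 'b::real_normed_vector) \<Rightarrow> bool" where
  "C1_on W U f \<longleftrightarrow>
     (\<exists>D. (\<forall>x\<in>U. (f has_derivative D x) (at x within U)) \<and>
          (\<forall>b\<in>W. continuous_on U (\<lambda>x. D x b)))"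

definition monogenic_on ::
    "'a::{euclidean_space, real_algebra_1} list \<Rightarrow> 'a set \<Rightarrow> ('a \<Rightarrow> 'a) \<Rightarrow> bool" where
  "monogenic_on bs U f \<longleftrightarrow>
     C1_on (span (set bs)) U f \<and> (\<forall>x\<in>U. (\<Sum>b\<leftarrow>bs. b * partial_deriv b f x) = 0)"

definition T_regular ::
    "(nat \<Rightarrow> 'a::{euclidean_space, real_algebra_1}) \<Rightarrow> nat list \<Rightarrow> 'a set \<Rightarrow> ('a \<Rightarrow> 'a) \<Rightarrow> bool" where
  "T_regular v T \<Omega> f \<longleftrightarrow>
     (\<forall>J\<in>torus v T. monogenic_on (slice_basis v T J) (\<Omega> \<inter> slice v T J) f)"

text \<open>
  Let \<open>bs = [b\<^sub>0, \<dots>, b\<^sub>m]\<close> be orthonormal. Up to the equator, which is a null set, the unit sphere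
  of the span of \<open>bs\<close> is the union of the graphs of \<open>\<plusminus>hemisphere m\<close> over the open unit disc in the
  hyperplane of \<open>b\<^sub>1, \<dots>, b\<^sub>m\<close>. The graph of \<open>\<gamma>\<close> has surface element
  \<open>sqrt (1 + (\<partial>\<^sub>1 \<gamma>)\<^sup>2 + \<dots> + (\<partial>\<^sub>m \<gamma>)\<^sup>2) du\<close>, which is unchanged if \<open>\<gamma>\<close> is replaced by \<open>-\<gamma>\<close>.
\<close>

definition lebesgue_coords :: "nat \<Rightarrow> (nat \<Rightarrow> real) measure" where
  "lebesgue_coords m = (\<Pi>\<^sub>M i\<in>{1..m}. lborel)"

definition open_unit_disc :: "nat \<Rightarrow> (nat \<Rightarrow> real) set" where
  "open_unit_disc m = {u \<in> space (lebesgue_coords m). (\<Sum>i=1..m. (u i)\<^sup>2) < 1}"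

definition hemisphere :: "nat \<Rightarrow> (nat \<Rightarrow> real) \<Rightarrow> real" where
  "hemisphere m u = sqrt (1 - (\<Sum>i=1..m. (u i)\<^sup>2))"

definition graph_element :: "nat \<Rightarrow> ((nat \<Rightarrow> real) \<Rightarrow> real) \<Rightarrow> (nat \<Rightarrow> real) \<Rightarrow> real" where
  "graph_element m \<gamma> u = sqrt (1 + (\<Sum>i=1..m. (deriv (\<lambda>s. \<gamma> (u(i := s))) (u i))\<^sup>2))"

definition sphere_surface :: "'a::euclidean_space list \<Rightarrow> 'a measure" where
  "sphere_surface bs =
     (let m = length bs - 1 in
       distr
         (density (count_space {1, -1 :: real} \<Otimes>\<^sub>M lebesgue_coords m)
           (\<lambda>(s, u). ennreal (graph_element m (hemisphere m) u) * indicator (open_unit_disc m) u))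
         borel
         (\<lambda>(s, u). (s * hemisphere m u) *\<^sub>R (bs ! 0) + (\<Sum>i=1..m. u i *\<^sub>R (bs ! i))))"

definition sphere_area :: "nat \<Rightarrow> real" where
  "sphere_area m = 2 * Gamma (1 / 2) ^ (m + 1) / Gamma ((real m + 1) / 2)"

end

theory Submission
  imports Defs
begin

text \<open>
  Write \<open>e\<^sub>0 = 1, e\<^sub>1, \<dots>, e\<^sub>m\<close> for the slice basis and let \<open>M r\<close> be the integral of
  \<open>f (p + r w)\<close> over the unit sphere of its span. Since \<open>M 0\<close> is the area of the sphere times
  \<open>f p\<close>, it suffices that \<open>M\<close> is constant on \<open>[0, R]\<close>.

  Its derivative is the integral of the radial derivative \<open>\<Sum>\<^sub>i w\<^sub>i \<partial>\<^sub>i f\<close>. Let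
  \<open>e\<^sub>0' = 1\<close> and \<open>e\<^sub>i' = - e\<^sub>i\<close> for \<open>i \<ge> 1\<close>, so that \<open>e\<^sub>i' e\<^sub>i = 1\<close> and
  \<open>e\<^sub>i' e\<^sub>j = - e\<^sub>j' e\<^sub>i\<close> for \<open>i \<noteq> j\<close>. Multiplying the equation \<open>\<Sum>\<^sub>j e\<^sub>j \<partial>\<^sub>j f = 0\<close> from
  the left by \<open>\<Sum>\<^sub>i w\<^sub>i e\<^sub>i'\<close>, which is where associativity enters, gives
  \<open>\<Sum>\<^sub>i\<^sub>j e\<^sub>i' e\<^sub>j (w\<^sub>i \<partial>\<^sub>j f) = 0\<close>. The diagonal terms add up to the radial derivative. The other
  coefficients are antisymmetric, so the other terms combine into the angular derivatives
  \<open>w\<^sub>i \<partial>\<^sub>j f - w\<^sub>j \<partial>\<^sub>i f\<close>. These are the derivatives of \<open>f\<close> along the rotations of the plane of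
  \<open>e\<^sub>i, e\<^sub>j\<close>, and their integrals vanish because the surface measure is invariant under rotations
  (\<open>moment_symmetric\<close>, \<open>radial_integral_zero\<close>). Hence \<open>M' = 0\<close> on \<open>(0, R)\<close>. Only first derivatives of \<open>f\<close>
  occur, so class \<open>C\<^sup>1\<close> is enough.

  The surface measure is given by two graphs over a disc, which hides its symmetry. Fix a coordinate
  \<open>u\<^sub>j\<close> of the disc and integrate over it first, with \<open>u\<^sub>j = a sin t\<close>: the two graphs supply the
  two halves of a circle of radius \<open>a\<close> in the plane of \<open>e\<^sub>0, e\<^sub>j\<close>, and the weight of the surface
  element becomes constant. So the sphere integral is an integral over a disc of dimension
  \<open>m - 1\<close> of integrals \<open>dt\<close> over full circles (\<open>nn_integral_sphere_surface_polar\<close>). In this form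
  the total mass is visibly \<open>2 pi\<close> times the volume of the unit ball of dimension \<open>m - 1\<close>, and
  rotating the plane of \<open>e\<^sub>0, e\<^sub>j\<close> only shifts \<open>t\<close>. Rotations of the remaining planes are
  conjugate to these (\<open>distr_sphere_surface_rotation\<close>).
\<close>

section \<open>The surface measure in polar form\<close>

text \<open>
  With \<open>\<gamma> = hemisphere m\<close> the partial derivatives are \<open>- u\<^sub>i / \<gamma>\<close>, and
  \<open>1 + \<bar>u\<bar>\<^sup>2 / \<gamma>\<^sup>2 = 1 / \<gamma>\<^sup>2\<close>.
\<close>

lemma graph_element_hemisphere:
  assumes "u \<in> open_unit_disc m"
  shows "graph_element m (hemisphere m) u = 1 / hemisphere m u"
proof -
  let ?q = "\<Sum>i=1..m. (u i)\<^sup>2"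
  have q: "?q < 1" using assms by (simp add: open_unit_disc_def)
  have h: "hemisphere m u > 0" "(hemisphere m u)\<^sup>2 = 1 - ?q"
    using q by (simp_all add: hemisphere_def)
  have d: "deriv (\<lambda>s. hemisphere m (u(i := s))) (u i) = - u i / hemisphere m u" if i: "i \<in> {1..m}" for i
  proof -
    define r where "r = (\<Sum>k\<in>{1..m}-{i}. (u k)\<^sup>2)"
    \<comment> \<open>As a function of the coordinate \<open>i\<close> alone, the hemisphere is a half circle.\<close>
    have sum: "(\<Sum>k=1..m. ((u(i := s)) k)\<^sup>2) = s\<^sup>2 + r" for s
      using i by (subst sum.remove[of _ i]) (auto simp: r_def intro!: sum.cong)
    have eq: "(\<lambda>s. hemisphere m (u(i := s))) = (\<lambda>s. sqrt (1 - (s\<^sup>2 + r)))"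
      by (simp only: hemisphere_def sum)
    have hu: "hemisphere m u = sqrt (1 - ((u i)\<^sup>2 + r))"
      using fun_cong[OF eq, of "u i"] by simp
    have pos: "1 - ((u i)\<^sup>2 + r) > 0"
      using h(1) by (simp add: hu)
    have "((\<lambda>s. sqrt (1 - (s\<^sup>2 + r))) has_real_derivative - u i / sqrt (1 - ((u i)\<^sup>2 + r))) (at (u i))"
      using pos by (auto intro!: derivative_eq_intros simp: field_simps)
    then show ?thesis
      unfolding eq hu by (rule DERIV_imp_deriv)
  qed
  have q': "?q = 1 - (hemisphere m u)\<^sup>2" using h(2) by simp
  have "(\<Sum>i=1..m. (deriv (\<lambda>s. hemisphere m (u(i := s))) (u i))\<^sup>2) = ?q / (hemisphere m u)\<^sup>2"
    by (simp add: d power_divide sum_divide_distrib)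
  then have "graph_element m (hemisphere m) u = sqrt (1 / (hemisphere m u)\<^sup>2)"
    using h(1) unfolding graph_element_def q' by (simp add: field_simps)
  then show ?thesis using h(1) by (simp add: real_sqrt_divide)
qed

lemma nn_integral_sphere_surface:
  assumes len: "length bs = Suc m" and h[measurable]: "h \<in> borel_measurable borel"
  shows "(\<integral>\<^sup>+w. h w \<partial>sphere_surface bs) =
    (\<integral>\<^sup>+u. ennreal (1 / hemisphere m u) * indicator (open_unit_disc m) u *
       (\<Sum>s\<in>{1,-1}. h ((s * hemisphere m u) *\<^sub>R (bs ! 0) + (\<Sum>i=1..m. u i *\<^sub>R (bs ! i))))
     \<partial>lebesgue_coords m)"
proof -
  have m: "length bs - 1 = m" using len by simp
  let ?C = "count_space {1, -1 :: real}"
  let ?P = "\<lambda>(s, u). (s * hemisphere m u) *\<^sub>R (bs ! 0) + (\<Sum>i=1..m. u i *\<^sub>R (bs ! i))"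
  let ?e = "\<lambda>u. ennreal (1 / hemisphere m u) * indicator (open_unit_disc m) u"
  interpret product_sigma_finite "\<lambda>_::nat. lborel :: real measure" by standard
  interpret L: sigma_finite_measure "lebesgue_coords m"
    unfolding lebesgue_coords_def by (rule sigma_finite) simp
  have [measurable]: "(\<lambda>u. u i) \<in> borel_measurable (lebesgue_coords m)" if "i \<in> {1..m}" for i
    using that unfolding lebesgue_coords_def by measurable
  have [measurable]: "hemisphere m \<in> borel_measurable (lebesgue_coords m)"
    unfolding hemisphere_def by measurable
  have [measurable]: "open_unit_disc m \<in> sets (lebesgue_coords m)"
    unfolding open_unit_disc_def by measurable
  have [measurable]: "(\<lambda>x. fst x) \<in> borel_measurable (?C \<Otimes>\<^sub>M lebesgue_coords m)"
    by (rule measurable_compose[OF measurable_fst]) simp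
  have [measurable]: "?P \<in> borel_measurable (?C \<Otimes>\<^sub>M lebesgue_coords m)"
    unfolding case_prod_beta by measurable
  have dens: "(\<lambda>(s::real, u). ennreal (graph_element m (hemisphere m) u) * indicator (open_unit_disc m) u)
      = (\<lambda>(s, u). ?e u)"
    by (auto simp: fun_eq_iff graph_element_hemisphere split: split_indicator)
  have "(\<integral>\<^sup>+w. h w \<partial>sphere_surface bs) =
      (\<integral>\<^sup>+w. h w \<partial>distr (density (?C \<Otimes>\<^sub>M lebesgue_coords m) (\<lambda>(s, u). ?e u)) borel ?P)"
    unfolding sphere_surface_def Let_def dens m ..
  also have "\<dots> = (\<integral>\<^sup>+x. h (?P x) \<partial>density (?C \<Otimes>\<^sub>M lebesgue_coords m) (\<lambda>(s, u). ?e u))"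
    by (rule nn_integral_distr) auto
  also have "\<dots> = (\<integral>\<^sup>+x. (case x of (s, u) \<Rightarrow> ?e u) * h (?P x) \<partial>(?C \<Otimes>\<^sub>M lebesgue_coords m))"
    by (rule nn_integral_density) measurable
  also have "\<dots> = (\<integral>\<^sup>+s. \<integral>\<^sup>+u. ?e u * h (?P (s, u)) \<partial>lebesgue_coords m \<partial>?C)"
    by (subst L.nn_integral_fst[symmetric]) auto
  also have "\<dots> = (\<Sum>s\<in>{1,-1}. \<integral>\<^sup>+u. ?e u * h (?P (s, u)) \<partial>lebesgue_coords m)"
    by (subst nn_integral_count_space_finite) auto
  also have "\<dots> = (\<integral>\<^sup>+u. (\<Sum>s\<in>{1,-1}. ?e u * h (?P (s, u))) \<partial>lebesgue_coords m)"
    by (subst nn_integral_sum) auto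
  finally show ?thesis
    by (simp add: distrib_left)
qed

text \<open>
  The substitution \<open>y = a sin t\<close> cancels the weight \<open>1 / sqrt (a\<^sup>2 - y\<^sup>2)\<close>. The upper graph is run
  through by \<open>t \<in> [-pi/2, pi/2]\<close>; the reflection \<open>t \<mapsto> pi - t\<close> places the lower one on
  \<open>[pi/2, 3 pi/2]\<close>, so that together they make up a full period.
\<close>

lemma nn_integral_circle_graphs:
  fixes H :: "real \<times> real \<Rightarrow> ennreal"
  assumes [measurable]: "H \<in> borel_measurable borel" and a: "a > 0"
  shows "(\<integral>\<^sup>+y. ennreal (1 / sqrt (a\<^sup>2 - y\<^sup>2)) * indicator {-a<..<a} y *
            (\<Sum>s\<in>{1,-1}. H (s * sqrt (a\<^sup>2 - y\<^sup>2), y)) \<partial>lborel) =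
         (\<integral>\<^sup>+t. H (a * cos t, a * sin t) * indicator {-pi/2..3*pi/2} t \<partial>lborel)"
proof -
  let ?f = "\<lambda>y. ennreal (1 / sqrt (a\<^sup>2 - y\<^sup>2)) * indicator {-a<..<a} y *
            (\<Sum>s\<in>{1,-1}. H (s * sqrt (a\<^sup>2 - y\<^sup>2), y))"
  have "(\<integral>\<^sup>+y. ?f y \<partial>lborel) = (\<integral>\<^sup>+y. ?f y * indicator {a * sin (-(pi/2))..a * sin (pi/2)} y \<partial>lborel)"
    by (intro nn_integral_cong) (auto split: split_indicator)
  also have "\<dots> = (\<integral>\<^sup>+t. ?f (a * sin t) * ennreal (a * cos t) * indicator {-(pi/2)..pi/2} t \<partial>lborel)"
  proof (rule nn_integral_substitution_aux)
    show "0 \<le> a * cos x" if "x \<in> {- (pi / 2)..pi / 2}" for x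
      using that a by (auto intro!: mult_nonneg_nonneg cos_ge_zero)
  qed (auto intro!: derivative_eq_intros continuous_intros simp: field_simps)
  also have "\<dots> = (\<integral>\<^sup>+t. H (a * cos t, a * sin t) * indicator {-(pi/2)..pi/2} t +
                        H (- (a * cos t), a * sin t) * indicator {-(pi/2)..pi/2} t \<partial>lborel)"
  proof (rule nn_integral_cong_AE)
    have "AE t in lborel. t \<notin> {-(pi/2), pi/2}"
      by (intro AE_not_in countable_imp_null_set_lborel) auto
    then show "AE t in lborel. ?f (a * sin t) * ennreal (a * cos t) * indicator {-(pi/2)..pi/2} t =
        H (a * cos t, a * sin t) * indicator {-(pi/2)..pi/2} t + H (- (a * cos t), a * sin t) * indicator {-(pi/2)..pi/2} t"
    proof eventually_elim
      case (elim t)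
      show ?case
      proof (cases "t \<in> {-(pi/2)<..<pi/2}")
        case True
        then have c: "cos t > 0" by (intro cos_gt_zero_pi) auto
        have "a\<^sup>2 - (a * sin t)\<^sup>2 = (a * cos t)\<^sup>2"
          unfolding power_mult_distrib cos_squared_eq by (simp add: algebra_simps)
        then have s: "sqrt (a\<^sup>2 - (a * sin t)\<^sup>2) = a * cos t"
          using a c by simp
        have "(sin t)\<^sup>2 < 1" using c by (simp add: sin_squared_eq)
        then have "\<bar>sin t\<bar> < 1" by (simp add: abs_square_less_1)
        then have i: "a * sin t \<in> {-a<..<a}"
          using a mult_strict_left_mono[of "sin t" 1 a] mult_strict_left_mono[of "-1" "sin t" a] by auto
        have e: "ennreal (1 / (a * cos t)) * x * ennreal (a * cos t) = x" for x
        proof -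
          have "ennreal (1 / (a * cos t)) * x * ennreal (a * cos t)
             = (ennreal (1 / (a * cos t)) * ennreal (a * cos t)) * x" by (simp add: mult_ac)
          also have "ennreal (1 / (a * cos t)) * ennreal (a * cos t) = 1"
            using a c by (subst ennreal_mult[symmetric]) auto
          finally show ?thesis by simp
        qed
        show ?thesis
          using True i by (simp add: s e)
      next
        case False
        then have "t \<notin> {-(pi/2)..pi/2}" using elim by auto
        then show ?thesis by simp
      qed
    qed
  qed
  also have "\<dots> = (\<integral>\<^sup>+t. H (a * cos t, a * sin t) * indicator {-(pi/2)..pi/2} t \<partial>lborel) +
                   (\<integral>\<^sup>+t. H (- (a * cos t), a * sin t) * indicator {-(pi/2)..pi/2} t \<partial>lborel)"
    by (rule nn_integral_add) measurable
  also have "(\<integral>\<^sup>+t. H (- (a * cos t), a * sin t) * indicator {-(pi/2)..pi/2} t \<partial>lborel) =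
      (\<integral>\<^sup>+t. H (a * cos t, a * sin t) * indicator {pi/2..3*pi/2} t \<partial>lborel)"
    by (subst nn_integral_real_affine[where c = "-1" and t = pi])
       (auto intro!: nn_integral_cong split: split_indicator)
  also have "(\<integral>\<^sup>+t. H (a * cos t, a * sin t) * indicator {-(pi/2)..pi/2} t \<partial>lborel) + \<dots> =
      (\<integral>\<^sup>+t. H (a * cos t, a * sin t) * indicator {-(pi/2)..pi/2} t +
              H (a * cos t, a * sin t) * indicator {pi/2..3*pi/2} t \<partial>lborel)"
    by (rule nn_integral_add[symmetric]) measurable
  also have "\<dots> = (\<integral>\<^sup>+t. H (a * cos t, a * sin t) * indicator {-pi/2..3*pi/2} t \<partial>lborel)"
    by (intro nn_integral_cong_AE AE_I[of _ _ "{pi/2}"]) (auto split: split_indicator)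
  finally show ?thesis .
qed

lemma nn_integral_periodic_shift:
  fixes k :: "real \<Rightarrow> ennreal"
  assumes [measurable]: "k \<in> borel_measurable borel" and per: "\<And>t. k (t + p) = k t"
    and "0 \<le> \<alpha>" "\<alpha> \<le> p"
  shows "(\<integral>\<^sup>+t. k (t + \<alpha>) * indicator {c..c+p} t \<partial>lborel) = (\<integral>\<^sup>+t. k t * indicator {c..c+p} t \<partial>lborel)"
proof -
  have per': "k (p + t) = k t" for t using per[of t] by (simp add: add.commute)
  have "(\<integral>\<^sup>+t. k (t + \<alpha>) * indicator {c..c+p} t \<partial>lborel) =
        (\<integral>\<^sup>+t. k t * indicator {c+\<alpha>..c+p+\<alpha>} t \<partial>lborel)"
    by (subst (2) nn_integral_real_affine[where c = 1 and t = \<alpha>])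
       (auto intro!: nn_integral_cong simp: add_ac split: split_indicator)
  also have "\<dots> = (\<integral>\<^sup>+t. k t * indicator {c+\<alpha>..c+p} t + k t * indicator {c+p..c+p+\<alpha>} t \<partial>lborel)"
    using assms(3,4) by (intro nn_integral_cong_AE AE_I[of _ _ "{c+p}"]) (auto split: split_indicator)
  also have "\<dots> = (\<integral>\<^sup>+t. k t * indicator {c+\<alpha>..c+p} t \<partial>lborel) + (\<integral>\<^sup>+t. k t * indicator {c+p..c+p+\<alpha>} t \<partial>lborel)"
    by (rule nn_integral_add) measurable
  also have "(\<integral>\<^sup>+t. k t * indicator {c+p..c+p+\<alpha>} t \<partial>lborel) = (\<integral>\<^sup>+t. k t * indicator {c..c+\<alpha>} t \<partial>lborel)"
    by (subst nn_integral_real_affine[where c = 1 and t = p])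
       (auto intro!: nn_integral_cong simp: per' split: split_indicator)
  also have "(\<integral>\<^sup>+t. k t * indicator {c+\<alpha>..c+p} t \<partial>lborel) + \<dots> =
      (\<integral>\<^sup>+t. k t * indicator {c+\<alpha>..c+p} t + k t * indicator {c..c+\<alpha>} t \<partial>lborel)"
    by (rule nn_integral_add[symmetric]) measurable
  also have "\<dots> = (\<integral>\<^sup>+t. k t * indicator {c..c+p} t \<partial>lborel)"
    using assms(3,4) by (intro nn_integral_cong_AE AE_I[of _ _ "{c+\<alpha>}"]) (auto split: split_indicator)
  finally show ?thesis .
qed

text \<open>
  Fubini: with the coordinates other than \<open>u\<^sub>j\<close> fixed, the two graphs over the remaining chord form
  a circle of radius \<open>sqrt (1 - \<bar>u\<bar>\<^sup>2)\<close>, on which the surface element is \<open>dt\<close> without a weight. The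
  directions \<open>bs ! 0\<close> and \<open>bs ! j\<close> now play equal parts, although the measure is defined by
  singling out \<open>bs ! 0\<close>.
\<close>

lemma nn_integral_sphere_surface_polar:
  fixes bs :: "'a::euclidean_space list"
  assumes len: "length bs = Suc m" and j: "j \<in> {1..m}" and h[measurable]: "h \<in> borel_measurable borel"
  shows "(\<integral>\<^sup>+w. h w \<partial>sphere_surface bs) =
    (\<integral>\<^sup>+u. indicator {u. (\<Sum>i\<in>{1..m}-{j}. (u i)\<^sup>2) < 1} u *
       (\<integral>\<^sup>+t. h ((sqrt (1 - (\<Sum>i\<in>{1..m}-{j}. (u i)\<^sup>2)) * cos t) *\<^sub>R (bs ! 0) +
                (sqrt (1 - (\<Sum>i\<in>{1..m}-{j}. (u i)\<^sup>2)) * sin t) *\<^sub>R (bs ! j) +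
                (\<Sum>i\<in>{1..m}-{j}. u i *\<^sub>R (bs ! i))) * indicator {-pi/2..3*pi/2} t \<partial>lborel)
     \<partial>(\<Pi>\<^sub>M i\<in>{1..m}-{j}. lborel))"
proof -
  interpret product_sigma_finite "\<lambda>_::nat. lborel :: real measure" by standard
  define K where "K = {1..m} - {j}"
  have ins: "{1..m} = insert j K" "finite K" "j \<notin> K" using j by (auto simp: K_def)
  let ?q = "\<lambda>u::nat \<Rightarrow> real. \<Sum>i\<in>K. (u i)\<^sup>2"
  let ?F = "\<lambda>u. ennreal (1 / hemisphere m u) * indicator (open_unit_disc m) u *
       (\<Sum>s\<in>{1,-1}. h ((s * hemisphere m u) *\<^sub>R (bs ! 0) + (\<Sum>i=1..m. u i *\<^sub>R (bs ! i))))"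
  have [measurable]: "(\<lambda>u. u i) \<in> borel_measurable (lebesgue_coords m)" if "i \<in> {1..m}" for i
    using that unfolding lebesgue_coords_def by measurable
  have [measurable]: "hemisphere m \<in> borel_measurable (lebesgue_coords m)"
    unfolding hemisphere_def by measurable
  have [measurable]: "open_unit_disc m \<in> sets (lebesgue_coords m)"
    unfolding open_unit_disc_def by measurable
  have "?F \<in> borel_measurable (lebesgue_coords m)"
    by measurable
  then have F: "?F \<in> borel_measurable (\<Pi>\<^sub>M i\<in>insert j K. lborel)"
    unfolding lebesgue_coords_def ins(1)[symmetric] .
  have "(\<integral>\<^sup>+w. h w \<partial>sphere_surface bs) = (\<integral>\<^sup>+u. ?F u \<partial>(\<Pi>\<^sub>M i\<in>insert j K. lborel))"
    unfolding nn_integral_sphere_surface[OF len h] lebesgue_coords_def ins(1)[symmetric] ..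
  also have "\<dots> = (\<integral>\<^sup>+u. \<integral>\<^sup>+y. ?F (u(j := y)) \<partial>lborel \<partial>(\<Pi>\<^sub>M i\<in>K. lborel))"
    by (rule product_nn_integral_insert[OF ins(2,3) F])
  also have "\<dots> = (\<integral>\<^sup>+u. indicator {u. ?q u < 1} u *
       (\<integral>\<^sup>+t. h ((sqrt (1 - ?q u) * cos t) *\<^sub>R (bs ! 0) + (sqrt (1 - ?q u) * sin t) *\<^sub>R (bs ! j) +
                (\<Sum>i\<in>K. u i *\<^sub>R (bs ! i))) * indicator {-pi/2..3*pi/2} t \<partial>lborel)
     \<partial>(\<Pi>\<^sub>M i\<in>K. lborel))"
  proof (rule nn_integral_cong)
    fix u :: "nat \<Rightarrow> real" assume u: "u \<in> space (\<Pi>\<^sub>M i\<in>K. lborel)"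
    have sp: "u(j := y) \<in> space (lebesgue_coords m)" for y
      using u j by (auto simp: lebesgue_coords_def space_PiM K_def PiE_def extensional_def)
    have sum1: "(\<Sum>i=1..m. ((u(j := y)) i)\<^sup>2) = y\<^sup>2 + ?q u" for y
      unfolding ins(1) using ins(2,3) by (subst sum.insert) (auto intro!: sum.cong)
    have sum2: "(\<Sum>i=1..m. (u(j := y)) i *\<^sub>R (bs ! i)) = y *\<^sub>R (bs ! j) + (\<Sum>i\<in>K. u i *\<^sub>R (bs ! i))" for y
      unfolding ins(1) using ins(2,3) by (subst sum.insert) (auto intro!: sum.cong)
    have disc: "u(j := y) \<in> open_unit_disc m \<longleftrightarrow> y\<^sup>2 + ?q u < 1" for y
      unfolding open_unit_disc_def using sp sum1 by simp
    show "(\<integral>\<^sup>+y. ?F (u(j := y)) \<partial>lborel) = indicator {u. ?q u < 1} u *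
       (\<integral>\<^sup>+t. h ((sqrt (1 - ?q u) * cos t) *\<^sub>R (bs ! 0) + (sqrt (1 - ?q u) * sin t) *\<^sub>R (bs ! j) +
                (\<Sum>i\<in>K. u i *\<^sub>R (bs ! i))) * indicator {-pi/2..3*pi/2} t \<partial>lborel)"
    proof (cases "?q u < 1")
      case False
      then have "u(j := y) \<notin> open_unit_disc m" for y
        using disc[of y] zero_le_power2[of y] by linarith
      then show ?thesis using False by simp
    next
      case True
      define a where "a = sqrt (1 - ?q u)"
      have a: "a > 0" "a\<^sup>2 = 1 - ?q u" using True by (simp_all add: a_def)
      have disc': "u(j := y) \<in> open_unit_disc m \<longleftrightarrow> y \<in> {-a<..<a}" for y
      proof -
        have "y\<^sup>2 + ?q u < 1 \<longleftrightarrow> y\<^sup>2 < a\<^sup>2" using a by auto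
        also have "\<dots> \<longleftrightarrow> \<bar>y\<bar> < a"
          using abs_le_square_iff[of a y] a(1) by (auto simp: not_le[symmetric])
        finally show ?thesis unfolding disc by auto
      qed
      have hem: "hemisphere m (u(j := y)) = sqrt (a\<^sup>2 - y\<^sup>2)" for y
        unfolding hemisphere_def sum1 a(2) by (simp add: algebra_simps)
      let ?H = "\<lambda>(x, y). h (x *\<^sub>R (bs ! 0) + y *\<^sub>R (bs ! j) + (\<Sum>i\<in>K. u i *\<^sub>R (bs ! i)))"
      have [measurable]: "?H \<in> borel_measurable borel"
        unfolding case_prod_beta
        by (rule measurable_compose[OF _ h]) (intro borel_measurable_continuous_onI continuous_intros)
      have "(\<integral>\<^sup>+y. ?F (u(j := y)) \<partial>lborel) = (\<integral>\<^sup>+y. ennreal (1 / sqrt (a\<^sup>2 - y\<^sup>2)) * indicator {-a<..<a} y *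
            (\<Sum>s\<in>{1,-1}. ?H (s * sqrt (a\<^sup>2 - y\<^sup>2), y)) \<partial>lborel)"
        unfolding hem sum2 indicator_def disc' by (simp add: add.assoc)
      also have "\<dots> = (\<integral>\<^sup>+t. ?H (a * cos t, a * sin t) * indicator {-pi/2..3*pi/2} t \<partial>lborel)"
        by (rule nn_integral_circle_graphs) (use a in auto)
      finally show ?thesis using True by (simp add: a_def[symmetric])
    qed
  qed
  finally show ?thesis unfolding K_def .
qed

text \<open>
  Exhausts the open ball by the closed balls of radius \<open>1 - 1 / (n + 2)\<close>, which is positive for
  every \<open>n\<close>.
\<close>

lemma nn_integral_open_unit_ball_PiM:
  fixes K :: "'i set"
  assumes "finite K"
  shows "(\<integral>\<^sup>+u. indicator {u. (\<Sum>i\<in>K. (u i)\<^sup>2) < 1} u \<partial>(\<Pi>\<^sub>M i\<in>K. (lborel :: real measure))) = ennreal (unit_ball_vol (card K))"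
proof -
  let ?P = "\<Pi>\<^sub>M i\<in>K. (lborel :: real measure)"
  let ?B = "\<lambda>n. {f. sqrt (\<Sum>i\<in>K. (f i)\<^sup>2) \<le> 1 - 1 / real (n+2)} \<inter> space ?P"
  have eq: "{u. (\<Sum>i\<in>K. (u i)\<^sup>2) < 1} \<inter> space ?P = (\<Union>n. ?B n)"
  proof (intro equalityI subsetI)
    fix u assume "u \<in> {u. (\<Sum>i\<in>K. (u i)\<^sup>2) < 1} \<inter> space ?P"
    then have u: "sqrt (\<Sum>i\<in>K. (u i)\<^sup>2) < 1" "u \<in> space ?P" by auto
    then obtain n where n: "inverse (real (Suc n)) < 1 - sqrt (\<Sum>i\<in>K. (u i)\<^sup>2)"
      using reals_Archimedean[of "1 - sqrt (\<Sum>i\<in>K. (u i)\<^sup>2)"] by auto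
    have "1 / real (n + 2) \<le> inverse (real (Suc n))" by (simp add: field_simps)
    then have "u \<in> ?B n" using u n by simp
    then show "u \<in> (\<Union>n. ?B n)" by blast
  next
    fix u assume "u \<in> (\<Union>n. ?B n)"
    then obtain n where n: "u \<in> ?B n" by blast
    have "sqrt (\<Sum>i\<in>K. (u i)\<^sup>2) \<le> 1 - 1 / real (n+2)" using n by simp
    also have "\<dots> < 1" by simp
    finally show "u \<in> {u. (\<Sum>i\<in>K. (u i)\<^sup>2) < 1} \<inter> space ?P" using n by simp
  qed
  have [measurable]: "?B n \<in> sets ?P" for n
    by measurable
  have inc: "incseq ?B"
  proof (rule incseq_SucI)
    fix n
    have "1 - 1 / real (n+2) \<le> 1 - 1 / real (Suc n + 2)" by (simp add: field_simps)
    then show "?B n \<le> ?B (Suc n)" by (auto intro: order_trans)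
  qed
  have "(\<lambda>n. emeasure ?P (?B n)) \<longlonglongrightarrow> emeasure ?P (\<Union>n. ?B n)"
    by (rule Lim_emeasure_incseq[OF _ inc]) auto
  moreover have "emeasure ?P (?B n) = ennreal (unit_ball_vol (card K) * (1 - 1 / real (n+2)) ^ card K)" for n
    by (rule emeasure_cball_aux[OF assms]) (simp add: field_simps)
  moreover have "(\<lambda>n. ennreal (unit_ball_vol (card K) * (1 - 1 / real (n+2)) ^ card K)) \<longlonglongrightarrow>
      ennreal (unit_ball_vol (card K) * (1 - 0) ^ card K)"
    by (intro tendsto_ennrealI tendsto_mult tendsto_power tendsto_diff tendsto_const
        LIMSEQ_ignore_initial_segment[OF lim_1_over_n])
  ultimately have "emeasure ?P (\<Union>n. ?B n) = ennreal (unit_ball_vol (card K) * (1 - 0) ^ card K)"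
    by (simp only: LIMSEQ_unique)
  moreover have "(\<integral>\<^sup>+u. indicator {u. (\<Sum>i\<in>K. (u i)\<^sup>2) < 1} u \<partial>?P) = (\<integral>\<^sup>+u. indicator (\<Union>n. ?B n) u \<partial>?P)"
    unfolding eq[symmetric] by (intro nn_integral_cong) (auto split: split_indicator)
  ultimately show ?thesis by simp
qed

text \<open>
  Both sides equal \<open>2 pi powr ((m + 1) / 2) / Gamma ((m + 1) / 2)\<close>. The right-hand side is the form
  in which the polar decomposition delivers the total mass.
\<close>

lemma sphere_area_eq:
  assumes "1 \<le> m"
  shows "sphere_area m = 2 * pi * unit_ball_vol (real (m - 1))"
proof -
  obtain k where m: "m = Suc k" using assms by (cases m) auto
  have "pi powr (real k / 2 + 1) = pi powr (real k / 2) * pi" by (simp add: powr_add)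
  moreover have "sqrt pi ^ (k + 2) = pi powr (real k / 2 + 1)"
  proof -
    have "sqrt pi ^ (k + 2) = (pi powr (1/2)) powr (real (k + 2))"
      by (subst powr_realpow) (auto simp: powr_half_sqrt)
    also have "\<dots> = pi powr (real k / 2 + 1)" unfolding powr_powr by (simp add: field_simps)
    finally show ?thesis .
  qed
  moreover have g: "(real m + 1) / 2 = real k / 2 + 1" by (simp add: m field_simps)
  ultimately show ?thesis
    unfolding sphere_area_def unit_ball_vol_def Gamma_one_half_real g by (simp add: m)
qed

section \<open>Total area and rotation invariance\<close>

text \<open>
  For orthonormal \<open>u, v\<close> this turns their plane by the angle \<open>t\<close> and fixes its orthogonal
  complement. It is written as a perturbation of the identity so that no projection is needed.
\<close>

definition plane_rotation :: "'a::real_inner \<Rightarrow> 'a \<Rightarrow> real \<Rightarrow> 'a \<Rightarrow> 'a" where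
  "plane_rotation u v t x =
     x + ((cos t - 1) * (x \<bullet> u) - sin t * (x \<bullet> v)) *\<^sub>R u
       + (sin t * (x \<bullet> u) + (cos t - 1) * (x \<bullet> v)) *\<^sub>R v"

lemma continuous_on_plane_rotation [continuous_intros]:
  "continuous_on A (plane_rotation u v t)"
  unfolding plane_rotation_def by (intro continuous_intros)

lemma borel_measurable_plane_rotation [measurable]:
  "plane_rotation u v t \<in> borel_measurable (borel :: 'a::euclidean_space measure)"
  by (intro borel_measurable_continuous_onI continuous_intros)

lemma orthonormal_familyD:
  "orthonormal_family m b \<Longrightarrow> i \<le> m \<Longrightarrow> j \<le> m \<Longrightarrow> b i \<bullet> b j = (if i = j then 1 else 0)"
  by (simp add: orthonormal_family_def)

lemma orthonormal_family_inner_sum: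
  assumes "orthonormal_family m b" "K \<subseteq> {..m}" "k \<le> m"
  shows "(\<Sum>i\<in>K. c i *\<^sub>R b i) \<bullet> b k = (if k \<in> K then c k else 0)"
proof -
  have "finite K" using assms(2) finite_subset by blast
  moreover have "(\<Sum>i\<in>K. c i *\<^sub>R b i) \<bullet> b k = (\<Sum>i\<in>K. if i = k then c i else 0)"
    unfolding inner_sum_left using assms
    by (intro sum.cong) (auto simp: orthonormal_familyD[OF assms(1)] subset_iff)
  ultimately show ?thesis by simp
qed

lemma sum_atMost_remove_two:
  fixes g :: "nat \<Rightarrow> 'b::comm_monoid_add"
  assumes "j \<in> {1..m}"
  shows "(\<Sum>i\<le>m. g i) = g 0 + (g j + (\<Sum>i\<in>{1..m}-{j}. g i))"
proof -
  have "(\<Sum>i\<le>m. g i) = g 0 + (\<Sum>i=1..m. g i)"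
    by (simp add: atMost_atLeast0 sum.atLeast_Suc_atMost)
  with assms show ?thesis by (simp only: sum.remove[of "{1..m}" j] finite_atLeastAtMost)
qed

lemma norm_circle_point:
  assumes on: "orthonormal_family m b" and j: "j \<in> {1..m}"
    and q: "(\<Sum>i\<in>{1..m}-{j}. (u i)\<^sup>2) < 1"
  defines "a \<equiv> sqrt (1 - (\<Sum>i\<in>{1..m}-{j}. (u i)\<^sup>2))"
  shows "norm ((a * cos t) *\<^sub>R b 0 + (a * sin t) *\<^sub>R b j + (\<Sum>i\<in>{1..m}-{j}. u i *\<^sub>R b i)) = 1"
proof -
  define c where "c = (\<lambda>i. if i = 0 then a * cos t else if i = j then a * sin t else u i)"
  note split = sum_atMost_remove_two[OF j]
  let ?x = "\<Sum>i\<le>m. c i *\<^sub>R b i"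
  have x: "(a * cos t) *\<^sub>R b 0 + (a * sin t) *\<^sub>R b j + (\<Sum>i\<in>{1..m}-{j}. u i *\<^sub>R b i) = ?x"
    unfolding split using j by (auto simp: c_def intro!: sum.cong)
  have "?x \<bullet> ?x = (\<Sum>i\<le>m. c i * (?x \<bullet> b i))" by (simp add: inner_sum_right)
  also have "\<dots> = (\<Sum>i\<le>m. (c i)\<^sup>2)"
    by (intro sum.cong) (simp_all add: orthonormal_family_inner_sum[OF on] power2_eq_square)
  also have "\<dots> = a\<^sup>2 * ((cos t)\<^sup>2 + (sin t)\<^sup>2) + (\<Sum>i\<in>{1..m}-{j}. (u i)\<^sup>2)"
  proof -
    have "(\<Sum>i\<in>{1..m}-{j}. (c i)\<^sup>2) = (\<Sum>i\<in>{1..m}-{j}. (u i)\<^sup>2)"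
      by (intro sum.cong) (auto simp: c_def)
    then show ?thesis unfolding split using j by (simp add: c_def power_mult_distrib flip: distrib_left)
  qed
  also have "\<dots> = 1" using q by (simp add: a_def)
  finally show ?thesis unfolding x by (simp add: norm_eq_sqrt_inner)
qed

lemma emeasure_sphere_surface:
  fixes bs :: "'a::euclidean_space list"
  assumes len: "length bs = Suc m" and m: "1 \<le> m" and on: "orthonormal_family m ((!) bs)"
    and A[measurable]: "A \<in> sets borel" and sub: "{w \<in> span (set bs). norm w = 1} \<subseteq> A"
  shows "emeasure (sphere_surface bs) A = ennreal (sphere_area m)"
proof -
  \<comment> \<open>The decomposition along any coordinate would do; \<open>m \<ge> 1\<close> makes \<open>m\<close> one of them.\<close>
  let ?K = "{1..m} - {m}"
  let ?q = "\<lambda>u::nat \<Rightarrow> real. \<Sum>i\<in>?K. (u i)\<^sup>2"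
  let ?x = "\<lambda>u t. (sqrt (1 - ?q u) * cos t) *\<^sub>R (bs ! 0) + (sqrt (1 - ?q u) * sin t) *\<^sub>R (bs ! m) + (\<Sum>i\<in>?K. u i *\<^sub>R (bs ! i))"
  have mm: "m \<in> {1..m}" using m by simp
  have inA: "?x u t \<in> A" if "?q u < 1" for u t
  proof -
    have "bs ! i \<in> span (set bs)" if "i \<le> m" for i
      using that len by (intro span_base) simp
    then have "?x u t \<in> span (set bs)"
      by (intro span_add span_sum span_mul) auto
    with norm_circle_point[OF on mm that] sub show ?thesis by blast
  qed
  have "emeasure (sphere_surface bs) A = (\<integral>\<^sup>+w. indicator A w \<partial>sphere_surface bs)"
    by (simp add: sphere_surface_def Let_def)
  also have "\<dots> = (\<integral>\<^sup>+u. indicator {u. ?q u < 1} u *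
       (\<integral>\<^sup>+t. indicator A (?x u t) * indicator {-pi/2..3*pi/2} t \<partial>lborel) \<partial>(\<Pi>\<^sub>M i\<in>?K. lborel))"
    by (rule nn_integral_sphere_surface_polar[OF len mm]) simp
  also have "\<dots> = (\<integral>\<^sup>+u. ennreal (2 * pi) * indicator {u. ?q u < 1} u \<partial>(\<Pi>\<^sub>M i\<in>?K. lborel))"
  proof (rule nn_integral_cong)
    fix u :: "nat \<Rightarrow> real"
    show "indicator {u. ?q u < 1} u * (\<integral>\<^sup>+t. indicator A (?x u t) * indicator {-pi/2..3*pi/2} t \<partial>lborel)
        = ennreal (2 * pi) * indicator {u. ?q u < 1} u"
    proof (cases "?q u < 1")
      case True
      then have "(\<integral>\<^sup>+t. indicator A (?x u t) * indicator {-pi/2..3*pi/2} t \<partial>lborel) = 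
          (\<integral>\<^sup>+t. indicator {-pi/2..3*pi/2} t \<partial>lborel)"
        by (intro nn_integral_cong) (simp only: indicator_simps(1)[OF inA] mult_1)
      also have "\<dots> = ennreal (2 * pi)" by simp
      finally show ?thesis using True by simp
    qed simp
  qed
  also have "\<dots> = ennreal (2 * pi) * (\<integral>\<^sup>+u. indicator {u. ?q u < 1} u \<partial>(\<Pi>\<^sub>M i\<in>?K. lborel))"
    by (rule nn_integral_cmult) measurable
  also have "\<dots> = ennreal (sphere_area m)"
    using m by (subst nn_integral_open_unit_ball_PiM)
      (simp_all add: sphere_area_eq ennreal_mult)
  finally show ?thesis .
qed

text \<open>
  In the polar decomposition along \<open>bs ! j\<close> the rotation shifts the angle by \<open>\<theta>\<close>, and the integral
  of a periodic function over a period does not change. The angle is first reduced to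
  \<open>[0, 2 pi)\<close>.
\<close>

lemma distr_sphere_surface_rotation_axis:
  fixes bs :: "'a::euclidean_space list"
  assumes len: "length bs = Suc m" and on: "orthonormal_family m ((!) bs)" and j: "j \<in> {1..m}"
  shows "distr (sphere_surface bs) borel (plane_rotation (bs ! 0) (bs ! j) \<theta>) = sphere_surface bs"
proof -
  obtain \<alpha> where \<alpha>: "0 \<le> \<alpha>" "\<alpha> < 2 * pi" "cos \<theta> = cos \<alpha>" "sin \<theta> = sin \<alpha>"
    using sincos_total_2pi[of "cos \<theta>" "sin \<theta>"] by auto
  have rot: "plane_rotation (bs ! 0) (bs ! j) \<theta> = plane_rotation (bs ! 0) (bs ! j) \<alpha>"
    by (simp add: plane_rotation_def fun_eq_iff \<alpha>(3,4))
  let ?K = "{1..m} - {j}"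
  let ?a = "\<lambda>u::nat \<Rightarrow> real. sqrt (1 - (\<Sum>i\<in>?K. (u i)\<^sup>2))"
  let ?y = "\<lambda>u::nat \<Rightarrow> real. \<Sum>i\<in>?K. u i *\<^sub>R (bs ! i)"
  let ?x = "\<lambda>u t. (?a u * cos t) *\<^sub>R (bs ! 0) + (?a u * sin t) *\<^sub>R (bs ! j) + ?y u"
  have step: "plane_rotation (bs ! 0) (bs ! j) \<alpha> (?x u t) = ?x u (t + \<alpha>)" for u t
  proof -
    have "?y u \<bullet> (bs ! 0) = 0" "?y u \<bullet> (bs ! j) = 0"
      using j by (subst orthonormal_family_inner_sum[OF on]; auto)+
    moreover have "bs ! 0 \<bullet> bs ! 0 = 1" "bs ! j \<bullet> bs ! j = 1" "bs ! 0 \<bullet> bs ! j = 0" "bs ! j \<bullet> bs ! 0 = 0"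
      using j orthonormal_familyD[OF on] by auto
    ultimately have "?x u t \<bullet> (bs ! 0) = ?a u * cos t" "?x u t \<bullet> (bs ! j) = ?a u * sin t"
      by (simp_all add: inner_add_left)
    then show ?thesis
      unfolding plane_rotation_def by (simp add: cos_add sin_add algebra_simps)
  qed
  have sets: "sets (sphere_surface bs) = sets borel" by (simp add: sphere_surface_def Let_def)
  show ?thesis unfolding rot
  proof (rule measure_eqI)
    fix A assume "A \<in> sets (distr (sphere_surface bs) borel (plane_rotation (bs ! 0) (bs ! j) \<alpha>))"
    then have [measurable]: "A \<in> sets borel" by simp
    have meas: "plane_rotation (bs ! 0) (bs ! j) \<alpha> \<in> measurable (sphere_surface bs) borel"
      using sets by (simp cong: measurable_cong_sets)
    have "emeasure (distr (sphere_surface bs) borel (plane_rotation (bs ! 0) (bs ! j) \<alpha>)) A =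
        (\<integral>\<^sup>+w. indicator A w \<partial>distr (sphere_surface bs) borel (plane_rotation (bs ! 0) (bs ! j) \<alpha>))"
      by simp
    also have "\<dots> = (\<integral>\<^sup>+w. indicator A (plane_rotation (bs ! 0) (bs ! j) \<alpha> w) \<partial>sphere_surface bs)"
      by (rule nn_integral_distr[OF meas]) simp
    also have "\<dots> = (\<integral>\<^sup>+u. indicator {u. (\<Sum>i\<in>?K. (u i)\<^sup>2) < 1} u *
       (\<integral>\<^sup>+t. indicator A (plane_rotation (bs ! 0) (bs ! j) \<alpha> (?x u t)) * indicator {-pi/2..3*pi/2} t \<partial>lborel) \<partial>(\<Pi>\<^sub>M i\<in>?K. lborel))"
      by (rule nn_integral_sphere_surface_polar[OF len j]) measurable
    also have "\<dots> = (\<integral>\<^sup>+u. indicator {u. (\<Sum>i\<in>?K. (u i)\<^sup>2) < 1} u *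
       (\<integral>\<^sup>+t. indicator A (?x u t) * indicator {-pi/2..3*pi/2} t \<partial>lborel) \<partial>(\<Pi>\<^sub>M i\<in>?K. lborel))"
    proof (rule nn_integral_cong)
      fix u :: "nat \<Rightarrow> real"
      have "(\<lambda>t. ?x u t) \<in> borel_measurable borel"
        by (intro borel_measurable_continuous_onI continuous_intros)
      then have k: "(\<lambda>t. indicator A (?x u t) :: ennreal) \<in> borel_measurable borel"
        by measurable
      have "(\<integral>\<^sup>+t. indicator A (plane_rotation (bs ! 0) (bs ! j) \<alpha> (?x u t)) * indicator {-pi/2..3*pi/2} t \<partial>lborel)
         = (\<integral>\<^sup>+t. indicator A (?x u t) * indicator {-pi/2..3*pi/2} t \<partial>lborel)"
        using nn_integral_periodic_shift[OF k, of "2 * pi" \<alpha> "-pi/2"] \<alpha>(1,2)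
        unfolding step by simp
      then show "indicator {u. (\<Sum>i\<in>?K. (u i)\<^sup>2) < 1} u *
       (\<integral>\<^sup>+t. indicator A (plane_rotation (bs ! 0) (bs ! j) \<alpha> (?x u t)) * indicator {-pi/2..3*pi/2} t \<partial>lborel) =
       indicator {u. (\<Sum>i\<in>?K. (u i)\<^sup>2) < 1} u * (\<integral>\<^sup>+t. indicator A (?x u t) * indicator {-pi/2..3*pi/2} t \<partial>lborel)"
        by simp
    qed
    also have "\<dots> = (\<integral>\<^sup>+w. indicator A w \<partial>sphere_surface bs)"
      by (rule nn_integral_sphere_surface_polar[OF len j, symmetric]) simp
    also have "\<dots> = emeasure (sphere_surface bs) A" by (simp add: sets)
    finally show "emeasure (distr (sphere_surface bs) borel (plane_rotation (bs ! 0) (bs ! j) \<alpha>)) A =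
      emeasure (sphere_surface bs) A" .
  qed (simp add: sets)
qed

text \<open>
  A quarter turn in the plane of \<open>bs ! 0, bs ! i\<close> carries \<open>bs ! 0\<close> to \<open>bs ! i\<close> and, for
  \<open>0 < i < j\<close>, fixes \<open>bs ! j\<close>. It therefore conjugates the rotations of the plane of
  \<open>bs ! 0, bs ! j\<close> into those of the plane of \<open>bs ! i, bs ! j\<close>.
\<close>

lemma distr_sphere_surface_rotation:
  fixes bs :: "'a::euclidean_space list"
  assumes len: "length bs = Suc m" and on: "orthonormal_family m ((!) bs)" and ij: "i < j" "j \<le> m"
  shows "distr (sphere_surface bs) borel (plane_rotation (bs ! i) (bs ! j) \<theta>) = sphere_surface bs"
proof (cases "i = 0")
  case True
  with ij show ?thesis using distr_sphere_surface_rotation_axis[OF len on, of j] by simp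
next
  case False
  let ?\<sigma> = "sphere_surface bs"
  let ?\<rho> = "plane_rotation (bs ! 0) (bs ! i) (pi/2)"
  have sets: "sets ?\<sigma> = sets borel" by (simp add: sphere_surface_def Let_def)
  have meas: "plane_rotation u v t \<in> measurable ?\<sigma> borel" for u v :: 'a and t
    using sets by (simp cong: measurable_cong_sets)
  have \<rho>: "distr ?\<sigma> borel ?\<rho> = ?\<sigma>"
    using False ij by (intro distr_sphere_surface_rotation_axis[OF len on]) auto
  have 0: "distr ?\<sigma> borel (plane_rotation (bs ! 0) (bs ! j) \<theta>) = ?\<sigma>"
    using False ij by (intro distr_sphere_surface_rotation_axis[OF len on]) auto
  have conj: "plane_rotation (bs ! i) (bs ! j) \<theta> (?\<rho> x) = ?\<rho> (plane_rotation (bs ! 0) (bs ! j) \<theta> x)" for x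
  proof -
    have o: "bs ! 0 \<bullet> bs ! 0 = 1" "bs ! i \<bullet> bs ! i = 1" "bs ! j \<bullet> bs ! j = 1"
      "bs ! 0 \<bullet> bs ! i = 0" "bs ! i \<bullet> bs ! 0 = 0" "bs ! 0 \<bullet> bs ! j = 0" "bs ! j \<bullet> bs ! 0 = 0"
      "bs ! i \<bullet> bs ! j = 0" "bs ! j \<bullet> bs ! i = 0"
      using False ij orthonormal_familyD[OF on] by auto
    show ?thesis
      unfolding plane_rotation_def by (simp add: inner_add_left o algebra_simps)
  qed
  have "distr ?\<sigma> borel (plane_rotation (bs ! i) (bs ! j) \<theta>) =
      distr (distr ?\<sigma> borel ?\<rho>) borel (plane_rotation (bs ! i) (bs ! j) \<theta>)"
    by (simp add: \<rho>)
  also have "\<dots> = distr ?\<sigma> borel (plane_rotation (bs ! i) (bs ! j) \<theta> \<circ> ?\<rho>)"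
    by (rule distr_distr) (auto simp: meas)
  also have "plane_rotation (bs ! i) (bs ! j) \<theta> \<circ> ?\<rho> = ?\<rho> \<circ> plane_rotation (bs ! 0) (bs ! j) \<theta>"
    by (simp add: fun_eq_iff conj)
  also have "distr ?\<sigma> borel (?\<rho> \<circ> plane_rotation (bs ! 0) (bs ! j) \<theta>) =
      distr (distr ?\<sigma> borel (plane_rotation (bs ! 0) (bs ! j) \<theta>)) borel ?\<rho>"
    by (rule distr_distr[symmetric]) (auto simp: meas)
  also have "\<dots> = ?\<sigma>" by (simp add: \<rho> 0)
  finally show ?thesis .
qed

lemma integral_sphere_surface_rotation:
  fixes bs :: "'a::euclidean_space list" and g :: "'a \<Rightarrow> 'b::{banach, second_countable_topology}"
  assumes len: "length bs = Suc m" and on: "orthonormal_family m ((!) bs)" and ij: "i < j" "j \<le> m"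
    and g: "g \<in> borel_measurable borel"
  shows "(LINT w|sphere_surface bs. g (plane_rotation (bs ! i) (bs ! j) \<theta> w)) = (LINT w|sphere_surface bs. g w)"
proof -
  have "sets (sphere_surface bs) = sets borel" by (simp add: sphere_surface_def Let_def)
  then have "plane_rotation (bs ! i) (bs ! j) \<theta> \<in> measurable (sphere_surface bs) borel"
    by (simp cong: measurable_cong_sets)
  from integral_distr[OF this g] show ?thesis
    unfolding distr_sphere_surface_rotation[OF len on ij] by simp
qed

section \<open>Derivatives of integrals and of rotations\<close>

text \<open>
  By the mean value inequality the difference quotients are bounded by \<open>C\<close>, a constant being
  integrable for a finite measure; dominated convergence does the rest.
\<close>

lemma has_vector_derivative_integral:
  fixes F :: "real \<Rightarrow> 'w \<Rightarrow> 'b::{banach, second_countable_topology}"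
  assumes "finite_measure M" and x: "x \<in> {a<..<b}"
    and int: "\<And>t. t \<in> {a<..<b} \<Longrightarrow> integrable M (F t)"
    and meas': "F' x \<in> borel_measurable M"
    and der: "\<And>t w. t \<in> {a<..<b} \<Longrightarrow> w \<in> space M \<Longrightarrow> ((\<lambda>t. F t w) has_vector_derivative F' t w) (at t)"
    and bound: "\<And>t w. t \<in> {a<..<b} \<Longrightarrow> w \<in> space M \<Longrightarrow> norm (F' t w) \<le> C"
  shows "((\<lambda>t. \<integral>w. F t w \<partial>M) has_vector_derivative (\<integral>w. F' x w \<partial>M)) (at x)"
proof -
  interpret finite_measure M by fact
  have int': "integrable M (F' x)"
    by (rule integrable_const_bound[of _ C]) (use x bound meas' in auto)
  have lip: "norm (F t w - F x w) \<le> C * norm (t - x)" if "t \<in> {a<..<b}" "w \<in> space M" for t w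
  proof (rule differentiable_bound[where S = "{a<..<b}" and f' = "\<lambda>t h. h *\<^sub>R F' t w"])
    show "((\<lambda>t. F t w) has_derivative (\<lambda>h. h *\<^sub>R F' s w)) (at s within {a<..<b})" if "s \<in> {a<..<b}" for s
      using der[OF that \<open>w \<in> space M\<close>] by (simp add: has_vector_derivative_def has_derivative_at_withinI)
    show "onorm (\<lambda>h. h *\<^sub>R F' s w) \<le> C" if "s \<in> {a<..<b}" for s
    proof (rule onorm_le)
      fix h :: real
      show "norm (h *\<^sub>R F' s w) \<le> C * norm h"
        using mult_right_mono[OF bound[OF that \<open>w \<in> space M\<close>], of "\<bar>h\<bar>"] by (simp add: mult.commute)
    qed
  qed (use that x in auto)
  let ?e = "\<lambda>y w. (1 / norm (y - x)) *\<^sub>R (F y w - (F x w + (y - x) *\<^sub>R F' x w))"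
  have "((\<lambda>y. \<integral>w. ?e y w \<partial>M) \<longlongrightarrow> 0) (at x)"
    unfolding tendsto_at_iff_sequentially
  proof (intro allI impI)
    fix Y :: "nat \<Rightarrow> real"
    assume "\<forall>i. Y i \<in> UNIV - {x}" and lim: "Y \<longlonglongrightarrow> x"
    then have ne: "Y n \<noteq> x" for n by auto
    have "eventually (\<lambda>n. Y n \<in> {a<..<b}) sequentially"
      using lim x by (intro topological_tendstoD[OF lim]) auto
    then obtain N where N: "\<And>n. n \<ge> N \<Longrightarrow> Y n \<in> {a<..<b}"
      by (auto simp: eventually_sequentially)
    have "(\<lambda>n. \<integral>w. ?e (Y (n + N)) w \<partial>M) \<longlonglongrightarrow> (\<integral>w. 0 \<partial>M)"
    proof (rule integral_dominated_convergence[where w = "\<lambda>_. 2 * C"])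
      show "?e (Y (n + N)) \<in> borel_measurable M" for n
        using int[OF N[of "n + N"]] int[OF x] meas' by auto
      show "AE w in M. (\<lambda>n. ?e (Y (n + N)) w) \<longlonglongrightarrow> 0"
      proof (rule AE_I2)
        fix w assume w: "w \<in> space M"
        have "((\<lambda>y. ?e y w) \<longlongrightarrow> 0) (at x)"
          using der[OF x w] unfolding has_vector_derivative_def has_derivative_at2 by simp
        then have "(\<lambda>n. ?e (Y n) w) \<longlonglongrightarrow> 0"
          using ne lim unfolding tendsto_at_iff_sequentially by (auto simp: o_def)
        then show "(\<lambda>n. ?e (Y (n + N)) w) \<longlonglongrightarrow> 0"
          by (rule LIMSEQ_ignore_initial_segment)
      qed
      show "AE w in M. norm (?e (Y (n + N)) w) \<le> 2 * C" for n
      proof (rule AE_I2)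
        fix w assume w: "w \<in> space M"
        let ?y = "Y (n + N)"
        have "norm (F ?y w - (F x w + (?y - x) *\<^sub>R F' x w)) \<le> norm (F ?y w - F x w) + norm ((?y - x) *\<^sub>R F' x w)"
          using norm_triangle_ineq4[of "F ?y w - F x w" "(?y - x) *\<^sub>R F' x w"] by (simp add: algebra_simps)
        also have "\<dots> \<le> C * norm (?y - x) + norm (?y - x) * C"
        proof (rule add_mono)
          show "norm (F ?y w - F x w) \<le> C * norm (?y - x)" by (rule lip[OF N w]) simp
          show "norm ((?y - x) *\<^sub>R F' x w) \<le> norm (?y - x) * C"
            unfolding norm_scaleR real_norm_def by (rule mult_left_mono[OF bound[OF x w]]) simp
        qed
        finally have "norm (F ?y w - (F x w + (?y - x) *\<^sub>R F' x w)) \<le> 2 * C * norm (?y - x)"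
          by (simp add: mult_ac)
        then show "norm (?e ?y w) \<le> 2 * C"
          unfolding norm_scaleR using ne[of "n + N"] by (simp add: pos_divide_le_eq)
      qed
    qed auto
    then have "(\<lambda>n. \<integral>w. ?e (Y (n + N)) w \<partial>M) \<longlonglongrightarrow> 0" by simp
    then show "((\<lambda>y. \<integral>w. ?e y w \<partial>M) \<circ> Y) \<longlonglongrightarrow> 0"
      unfolding o_def by (rule LIMSEQ_offset)
  qed
  moreover have "eventually (\<lambda>y. y \<in> {a<..<b}) (at x)"
    using x by (intro eventually_at_in_open') auto
  then have "eventually (\<lambda>y. (\<integral>w. ?e y w \<partial>M) =
      (1 / norm (y - x)) *\<^sub>R ((\<integral>w. F y w \<partial>M) - ((\<integral>w. F x w \<partial>M) + (y - x) *\<^sub>R (\<integral>w. F' x w \<partial>M)))) (at x)"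
  proof eventually_elim
    case (elim y)
    then show ?case using int[OF elim] int[OF x] int' by simp
  qed
  ultimately have "((\<lambda>y. (1 / norm (y - x)) *\<^sub>R ((\<integral>w. F y w \<partial>M) -
      ((\<integral>w. F x w \<partial>M) + (y - x) *\<^sub>R (\<integral>w. F' x w \<partial>M)))) \<longlongrightarrow> 0) (at x)"
    by (rule Lim_transform_eventually)
  then show ?thesis
    unfolding has_vector_derivative_def has_derivative_at2 using bounded_linear_scaleR_left by blast
qed

lemma continuous_on_integral:
  fixes F :: "real \<Rightarrow> 'w \<Rightarrow> 'b::{banach, second_countable_topology}"
  assumes "finite_measure M"
    and meas: "\<And>t. t \<in> A \<Longrightarrow> F t \<in> borel_measurable M"
    and cont: "\<And>w. w \<in> space M \<Longrightarrow> continuous_on A (\<lambda>t. F t w)"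
    and bound: "\<And>t w. t \<in> A \<Longrightarrow> w \<in> space M \<Longrightarrow> norm (F t w) \<le> C"
  shows "continuous_on A (\<lambda>t. \<integral>w. F t w \<partial>M)"
  unfolding continuous_on_sequentially
proof (intro allI impI ballI, elim conjE)
  fix Y t assume t: "t \<in> A" and Y: "\<forall>n. Y n \<in> A" "Y \<longlonglongrightarrow> t"
  interpret finite_measure M by fact
  show "((\<lambda>t. \<integral>w. F t w \<partial>M) \<circ> Y) \<longlonglongrightarrow> (\<integral>w. F t w \<partial>M)"
    unfolding o_def
  proof (rule integral_dominated_convergence[where w = "\<lambda>_. C"])
    show "AE w in M. (\<lambda>n. F (Y n) w) \<longlonglongrightarrow> F t w"
      using cont t Y unfolding continuous_on_sequentially by (auto simp: o_def)
  qed (use meas bound t Y in auto)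
qed

lemma plane_rotation_inner:
  assumes "u \<bullet> u = 1" "v \<bullet> v = 1" "u \<bullet> v = 0"
  shows "plane_rotation u v t x \<bullet> u = cos t * (x \<bullet> u) - sin t * (x \<bullet> v)"
    and "plane_rotation u v t x \<bullet> v = sin t * (x \<bullet> u) + cos t * (x \<bullet> v)"
  using assms by (simp_all add: plane_rotation_def inner_add_left inner_commute[of v u] algebra_simps)

text \<open>
  Provides the converse direction in the statement that a rotation of a slice plane maps the unit
  sphere of the slice onto itself.
\<close>

lemma plane_rotation_inverse:
  assumes "u \<bullet> u = 1" "v \<bullet> v = 1" "u \<bullet> v = 0"
  shows "plane_rotation u v (-t) (plane_rotation u v t x) = x"
proof -
  let ?y = "plane_rotation u v t x"
  have y: "?y = x + (?y \<bullet> u - x \<bullet> u) *\<^sub>R u + (?y \<bullet> v - x \<bullet> v) *\<^sub>R v"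
    unfolding plane_rotation_inner[OF assms] by (simp add: plane_rotation_def algebra_simps)
  have "cos t * cos t = 1 - sin t * sin t"
    by (simp only: power2_eq_square[symmetric] cos_squared_eq)
  then have cs: "cos t * (cos t * z) = z - sin t * (sin t * z)" for z
    by (simp add: left_diff_distrib flip: mult.assoc)
  have "(cos t - 1) * (?y \<bullet> u) + sin t * (?y \<bullet> v) = x \<bullet> u - ?y \<bullet> u"
    "- sin t * (?y \<bullet> u) + (cos t - 1) * (?y \<bullet> v) = x \<bullet> v - ?y \<bullet> v"
    unfolding plane_rotation_inner[OF assms] by (simp_all add: algebra_simps cs)
  then have "plane_rotation u v (-t) ?y = ?y + (x \<bullet> u - ?y \<bullet> u) *\<^sub>R u + (x \<bullet> v - ?y \<bullet> v) *\<^sub>R v"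
    by (simp add: plane_rotation_def[of u v "-t"])
  also have "\<dots> = x" by (subst (1) y) (simp add: algebra_simps)
  finally show ?thesis .
qed

lemma norm_plane_rotation:
  assumes "u \<bullet> u = 1" "v \<bullet> v = 1" "u \<bullet> v = 0"
  shows "norm (plane_rotation u v t x) = norm x"
proof -
  have "cos t * cos t = 1 - sin t * sin t"
    by (simp only: power2_eq_square[symmetric] cos_squared_eq)
  then have cs: "cos t * (cos t * z) = z - sin t * (sin t * z)" for z
    by (simp add: left_diff_distrib flip: mult.assoc)
  have "plane_rotation u v t x \<bullet> plane_rotation u v t x = plane_rotation u v t x \<bullet> x
    + ((cos t - 1) * (x \<bullet> u) - sin t * (x \<bullet> v)) * (plane_rotation u v t x \<bullet> u)
    + (sin t * (x \<bullet> u) + (cos t - 1) * (x \<bullet> v)) * (plane_rotation u v t x \<bullet> v)"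
    by (subst (2) plane_rotation_def) (simp add: inner_add_right)
  also have "plane_rotation u v t x \<bullet> x = x \<bullet> x
    + ((cos t - 1) * (x \<bullet> u) - sin t * (x \<bullet> v)) * (x \<bullet> u)
    + (sin t * (x \<bullet> u) + (cos t - 1) * (x \<bullet> v)) * (x \<bullet> v)"
    by (simp add: plane_rotation_def inner_add_left inner_commute[of u x] inner_commute[of v x])
  finally have "plane_rotation u v t x \<bullet> plane_rotation u v t x = x \<bullet> x"
    unfolding plane_rotation_inner[OF assms] by (simp add: algebra_simps cs)
  then show ?thesis by (simp add: norm_eq_sqrt_inner)
qed

text \<open>
  Differentiation under the integral asks for a bound at all times near \<open>0\<close>. Since rotations are the
  flow of the angular vector field \<open>y \<mapsto> \<langle>y, u\<rangle> v - \<langle>y, v\<rangle> u\<close>, the derivative at any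
  time is that field at the rotated point, and a bound on the sphere suffices.
\<close>

lemma has_vector_derivative_plane_rotation:
  assumes "u \<bullet> u = 1" "v \<bullet> v = 1" "u \<bullet> v = 0"
  shows "((\<lambda>t. plane_rotation u v t x) has_vector_derivative
     (plane_rotation u v t x \<bullet> u) *\<^sub>R v - (plane_rotation u v t x \<bullet> v) *\<^sub>R u) (at t)"
proof -
  have "((\<lambda>t. (cos t - 1) * (x \<bullet> u) - sin t * (x \<bullet> v)) has_real_derivative
      (- sin t - 0) * (x \<bullet> u) - cos t * (x \<bullet> v)) (at t)"
    "((\<lambda>t. sin t * (x \<bullet> u) + (cos t - 1) * (x \<bullet> v)) has_real_derivative
      cos t * (x \<bullet> u) + (- sin t - 0) * (x \<bullet> v)) (at t)"
    by (intro DERIV_diff DERIV_add DERIV_cmult_right DERIV_cos DERIV_sin DERIV_const)+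
  note this[THEN has_vector_derivative_scaleR, OF has_vector_derivative_const]
  from has_vector_derivative_add[OF has_vector_derivative_add[OF has_vector_derivative_const[of x] this(1)[of u]] this(2)[of v]]
  have "((\<lambda>t. plane_rotation u v t x) has_vector_derivative
     (- sin t * (x \<bullet> u) - cos t * (x \<bullet> v)) *\<^sub>R u + (cos t * (x \<bullet> u) - sin t * (x \<bullet> v)) *\<^sub>R v) (at t)"
    by (simp add: plane_rotation_def)
  then show ?thesis
    unfolding plane_rotation_inner[OF assms] by (simp add: algebra_simps)
qed

lemma orthonormal_expansion:
  assumes len: "length bs = Suc m" and on: "orthonormal_family m ((!) bs)" and w: "w \<in> span (set bs)"
  shows "(\<Sum>i\<le>m. (w \<bullet> bs ! i) *\<^sub>R bs ! i) = w"
  using w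
proof (induction rule: span_induct)
  case base
  show ?case
  proof (rule subspaceI; unfold mem_Collect_eq)
    fix x y :: 'a and r :: real
    assume x: "(\<Sum>i\<le>m. (x \<bullet> bs ! i) *\<^sub>R bs ! i) = x"
    have "(\<Sum>i\<le>m. ((r *\<^sub>R x) \<bullet> bs ! i) *\<^sub>R bs ! i) = r *\<^sub>R (\<Sum>i\<le>m. (x \<bullet> bs ! i) *\<^sub>R bs ! i)"
      unfolding scaleR_sum_right by simp
    then show "(\<Sum>i\<le>m. ((r *\<^sub>R x) \<bullet> bs ! i) *\<^sub>R bs ! i) = r *\<^sub>R x" unfolding x .
    assume y: "(\<Sum>i\<le>m. (y \<bullet> bs ! i) *\<^sub>R bs ! i) = y"
    have "(\<Sum>i\<le>m. ((x + y) \<bullet> bs ! i) *\<^sub>R bs ! i) =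
        (\<Sum>i\<le>m. (x \<bullet> bs ! i) *\<^sub>R bs ! i) + (\<Sum>i\<le>m. (y \<bullet> bs ! i) *\<^sub>R bs ! i)"
      unfolding inner_add_left scaleR_add_left sum.distrib ..
    then show "(\<Sum>i\<le>m. ((x + y) \<bullet> bs ! i) *\<^sub>R bs ! i) = x + y" unfolding x y .
  qed simp
next
  case (step x)
  then obtain k where k: "k \<le> m" "x = bs ! k" using len by (metis in_set_conv_nth less_Suc_eq_le)
  have "(\<Sum>i\<le>m. (x \<bullet> bs ! i) *\<^sub>R bs ! i) = (\<Sum>i\<le>m. if i = k then bs ! i else 0)"
    using k orthonormal_familyD[OF on] by (intro sum.cong) auto
  then show ?case using k by simp
qed

section \<open>The mean value property of null solutions of the Dirac operator\<close>

text \<open>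
  The norm is not assumed to be submultiplicative, but in finite dimension every linear map is
  bounded; this is what allows constants of the algebra to be pulled out of integrals.
\<close>

lemma bounded_linear_left_mult:
  "bounded_linear (\<lambda>x. c * x :: 'a::{euclidean_space, real_algebra_1})"
  unfolding linear_conv_bounded_linear[symmetric] by (rule linearI) (simp_all add: distrib_left)

text \<open>
  The part of the setting that the mean value property depends on. The derivative \<open>D x\<close> is taken
  within \<open>U\<close>, so it carries information about directions in the span of \<open>bs\<close> only. The left-hand
  side of \<open>dirac\<close> is the operator of \<open>monogenic_on\<close>, with \<open>D x (bs ! j)\<close> for the partial
  derivatives.
\<close>

locale dirac_null_solution =
  fixes bs :: "'a::{euclidean_space, real_algebra_1} list" and m :: nat
    and U :: "'a set" and f :: "'a \<Rightarrow> 'a" and D :: "'a \<Rightarrow> 'a \<Rightarrow> 'a" and p :: 'a and R :: real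
  assumes len: "length bs = Suc m" and m_pos: "1 \<le> m" and on: "orthonormal_family m ((!) bs)"
    and unit0: "bs ! 0 = 1"
    and square: "\<And>i. i \<in> {1..m} \<Longrightarrow> bs ! i * bs ! i = -1"
    and anticomm: "\<And>i j. i \<in> {1..m} \<Longrightarrow> j \<in> {1..m} \<Longrightarrow> i \<noteq> j \<Longrightarrow> bs ! i * bs ! j = - (bs ! j * bs ! i)"
    and U_sub: "U \<subseteq> span (set bs)"
    and deriv_f: "\<And>x. x \<in> U \<Longrightarrow> (f has_derivative D x) (at x within U)"
    and cont_D: "\<And>b. b \<in> span (set bs) \<Longrightarrow> continuous_on U (\<lambda>x. D x b)"
    and dirac: "\<And>x. x \<in> U \<Longrightarrow> (\<Sum>j\<le>m. bs ! j * D x (bs ! j)) = 0"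
    and R_pos: "R > 0"
    and p_span: "p \<in> span (set bs)"
    and ball_U: "\<And>x. x \<in> span (set bs) \<Longrightarrow> norm (x - p) \<le> R \<Longrightarrow> x \<in> U"
begin

definition S :: "'a set" where "S = {w \<in> span (set bs). norm w = 1}"
abbreviation \<sigma> :: "'a measure" where "\<sigma> \<equiv> sphere_surface bs"

lemma sets_\<sigma>: "sets \<sigma> = sets borel" by (simp add: sphere_surface_def Let_def)
lemma space_\<sigma>: "space \<sigma> = UNIV" by (simp add: sphere_surface_def Let_def)

lemma S_eq: "S = span (set bs) \<inter> sphere 0 1" by (auto simp: S_def)

lemma borel_S [measurable]: "S \<in> sets borel"
  unfolding S_eq by (intro sets.Int borel_closed closed_subspace subspace_span closed_sphere)

lemma finite_\<sigma>: "finite_measure \<sigma>"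
  by (rule finite_measureI)
     (simp add: emeasure_sphere_surface[OF len m_pos on] space_\<sigma>)

lemma bs_span: "i \<le> m \<Longrightarrow> bs ! i \<in> span (set bs)"
  using len by (intro span_base) simp

lemma point_U: "w \<in> S \<Longrightarrow> 0 \<le> r \<Longrightarrow> r \<le> R \<Longrightarrow> p + r *\<^sub>R w \<in> U"
  using p_span by (intro ball_U span_add span_mul) (auto simp: S_def)

lemma norm_S: "w \<in> S \<Longrightarrow> norm w = 1"
  and span_S: "w \<in> S \<Longrightarrow> w \<in> span (set bs)"
  by (simp_all add: S_def)

lemma linear_D: "x \<in> U \<Longrightarrow> linear (D x)"
  using deriv_f has_derivative_linear by blast

text \<open>
  Reduces arbitrary directions, in particular the radial one, to the finitely many partial
  derivatives that are known to be continuous.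
\<close>

lemma D_expand:
  assumes "x \<in> U" "w \<in> span (set bs)"
  shows "D x w = (\<Sum>i\<le>m. (w \<bullet> bs ! i) *\<^sub>R D x (bs ! i))"
proof -
  have "D x w = D x (\<Sum>i\<le>m. (w \<bullet> bs ! i) *\<^sub>R bs ! i)"
    by (simp only: orthonormal_expansion[OF len on assms(2)])
  then show ?thesis by (simp add: linear_sum[OF linear_D[OF assms(1)]] linear_scale[OF linear_D[OF assms(1)]])
qed

lemma coord_bound: "norm w = 1 \<Longrightarrow> i \<le> m \<Longrightarrow> \<bar>w \<bullet> bs ! i\<bar> \<le> 1"
  using Cauchy_Schwarz_ineq2[of w "bs ! i"] orthonormal_familyD[OF on, of i i]
  by (simp add: norm_eq_sqrt_inner)

definition bounds_on_ball :: "real \<Rightarrow> bool" where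
  "bounds_on_ball C \<longleftrightarrow> C \<ge> 0 \<and> (\<forall>w\<in>S. \<forall>r\<in>{0..R}. norm (f (p + r *\<^sub>R w)) \<le> C \<and>
     norm (D (p + r *\<^sub>R w) w) \<le> C \<and> (\<forall>i\<le>m. norm (D (p + r *\<^sub>R w) (bs ! i)) \<le> C))"

lemma bounds_on_ballD:
  assumes "bounds_on_ball C"
  shows "C \<ge> 0"
    and "\<And>w r. w \<in> S \<Longrightarrow> 0 \<le> r \<Longrightarrow> r \<le> R \<Longrightarrow> norm (f (p + r *\<^sub>R w)) \<le> C"
    and "\<And>w r. w \<in> S \<Longrightarrow> 0 \<le> r \<Longrightarrow> r \<le> R \<Longrightarrow> norm (D (p + r *\<^sub>R w) w) \<le> C"
    and "\<And>w r i. w \<in> S \<Longrightarrow> 0 \<le> r \<Longrightarrow> r \<le> R \<Longrightarrow> i \<le> m \<Longrightarrow> norm (D (p + r *\<^sub>R w) (bs ! i)) \<le> C"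
  using assms by (auto simp: bounds_on_ball_def)

text \<open>
  The closed ball of the span is compact, and the radial derivative is bounded through the partial
  ones because the coordinates of a unit vector are at most \<open>1\<close>.
\<close>

lemma ex_bounds_on_ball: "\<exists>C. bounds_on_ball C"
proof -
  let ?K = "span (set bs) \<inter> cball p R"
  have KU: "?K \<subseteq> U" using ball_U by (auto simp: dist_norm norm_minus_commute)
  have inK: "p + r *\<^sub>R w \<in> ?K" if "w \<in> S" "0 \<le> r" "r \<le> R" for w r
    using that p_span by (auto simp: dist_norm S_def intro!: span_add span_mul)
  have K: "compact ?K"
    by (intro closed_Int_compact closed_subspace subspace_span compact_cball)
  have "continuous_on U f" using deriv_f has_derivative_continuous_on by blast
  then have "continuous_on ?K (\<lambda>x. norm (f x) + (\<Sum>i\<le>m. norm (D x (bs ! i))))"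
    using KU cont_D[OF bs_span] by (intro continuous_intros) (auto intro: continuous_on_subset)
  then have "bounded ((\<lambda>x. norm (f x) + (\<Sum>i\<le>m. norm (D x (bs ! i)))) ` ?K)"
    using K compact_continuous_image compact_imp_bounded by blast
  then obtain C where "\<forall>y\<in>(\<lambda>x. norm (f x) + (\<Sum>i\<le>m. norm (D x (bs ! i)))) ` ?K. norm y \<le> C"
    unfolding bounded_iff by blast
  then have C: "norm (norm (f x) + (\<Sum>i\<le>m. norm (D x (bs ! i)))) \<le> C" if "x \<in> ?K" for x
    using that by blast
  have sn: "0 \<le> (\<Sum>i\<le>m. norm (D x (bs ! i)))" for x by (intro sum_nonneg) simp
  have C': "norm (f x) \<le> C" "(\<Sum>i\<le>m. norm (D x (bs ! i))) \<le> C" if "x \<in> ?K" for x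
    using C[OF that] sn[of x] norm_ge_zero[of "f x"] unfolding real_norm_def by linarith+
  have "p \<in> ?K" using p_span R_pos by simp
  from C'(1)[OF this] have C0: "C \<ge> 0" using norm_ge_zero order_trans by blast
  have Di: "norm (D x (bs ! i)) \<le> C" if "x \<in> ?K" "i \<le> m" for x i
  proof -
    have "norm (D x (bs ! i)) \<le> (\<Sum>i\<le>m. norm (D x (bs ! i)))"
      using that by (intro member_le_sum) auto
    then show ?thesis using C'(2)[OF that(1)] by linarith
  qed
  have Dw: "norm (D (p + r *\<^sub>R w) w) \<le> C" if w: "w \<in> S" "0 \<le> r" "r \<le> R" for w r
  proof -
    have "norm (D (p + r *\<^sub>R w) w) \<le> (\<Sum>i\<le>m. norm ((w \<bullet> bs ! i) *\<^sub>R D (p + r *\<^sub>R w) (bs ! i)))"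
      unfolding D_expand[OF point_U[OF w] span_S[OF w(1)]] by (rule norm_sum)
    also have "\<dots> \<le> (\<Sum>i\<le>m. norm (D (p + r *\<^sub>R w) (bs ! i)))"
      using coord_bound[OF norm_S[OF w(1)]] by (intro sum_mono) (auto intro: mult_left_le_one_le)
    finally show ?thesis using C'(2)[OF inK[OF w]] by linarith
  qed
  have "bounds_on_ball C"
    unfolding bounds_on_ball_def using C0 Di[OF inK] Dw C'(1)[OF inK] by simp
  then show ?thesis by blast
qed

lemma measurable_on_S:
  fixes g :: "'a \<Rightarrow> 'b::{real_normed_vector}"
  assumes "continuous_on S g"
  shows "(\<lambda>w. indicator S w *\<^sub>R g w) \<in> borel_measurable \<sigma>"
  using borel_measurable_continuous_on_indicator[OF borel_S assms]
  by (simp add: sets_\<sigma> cong: measurable_cong_sets)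

lemma integrable_on_S:
  fixes g :: "'a \<Rightarrow> 'b::euclidean_space"
  assumes "continuous_on S g" "\<And>w. w \<in> S \<Longrightarrow> norm (g w) \<le> C"
  shows "integrable \<sigma> (\<lambda>w. indicator S w *\<^sub>R g w)"
proof -
  interpret finite_measure \<sigma> by (rule finite_\<sigma>)
  show ?thesis
  proof (rule integrable_const_bound[of _ "\<bar>C\<bar>"])
    have "norm (indicator S w *\<^sub>R g w) \<le> \<bar>C\<bar>" for w
      using assms(2)[of w] by (auto split: split_indicator)
    then show "AE w in \<sigma>. norm (indicator S w *\<^sub>R g w) \<le> \<bar>C\<bar>" by simp
  qed (rule measurable_on_S[OF assms(1)])
qed

lemma cont_f_sphere: "0 \<le> r \<Longrightarrow> r \<le> R \<Longrightarrow> continuous_on S (\<lambda>w. f (p + r *\<^sub>R w))"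
proof -
  assume r: "0 \<le> r" "r \<le> R"
  have "continuous_on U f" using deriv_f has_derivative_continuous_on by blast
  then show ?thesis
    by (rule continuous_on_compose2) (use point_U r in \<open>auto intro!: continuous_intros\<close>)
qed

lemma cont_D_sphere: "0 \<le> r \<Longrightarrow> r \<le> R \<Longrightarrow> i \<le> m \<Longrightarrow> continuous_on S (\<lambda>w. D (p + r *\<^sub>R w) (bs ! i))"
  by (rule continuous_on_compose2[OF cont_D[OF bs_span]])
     (use point_U in \<open>auto intro!: continuous_intros\<close>)

lemma cont_radial_sphere:
  assumes "0 \<le> r" "r \<le> R" shows "continuous_on S (\<lambda>w. D (p + r *\<^sub>R w) w)"
proof -
  have "continuous_on S (\<lambda>w. \<Sum>i\<le>m. (w \<bullet> bs ! i) *\<^sub>R D (p + r *\<^sub>R w) (bs ! i))"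
    using assms cont_D_sphere by (intro continuous_intros) auto
  then show ?thesis
    by (rule continuous_on_eq) (simp add: D_expand[OF point_U span_S] assms)
qed

definition spherical_mean :: "real \<Rightarrow> 'a" where
  "spherical_mean r = (\<integral>w. indicator S w *\<^sub>R f (p + r *\<^sub>R w) \<partial>\<sigma>)"

lemma continuous_on_spherical_mean: "continuous_on {0..R} spherical_mean"
proof -
  obtain C where "bounds_on_ball C" using ex_bounds_on_ball by blast
  note C = bounds_on_ballD[OF this]
  have contf: "continuous_on U f" using deriv_f has_derivative_continuous_on by blast
  show ?thesis
    unfolding spherical_mean_def
  proof (rule continuous_on_integral[OF finite_\<sigma>])
    show "(\<lambda>w. indicator S w *\<^sub>R f (p + r *\<^sub>R w)) \<in> borel_measurable \<sigma>" if "r \<in> {0..R}" for r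
      using that by (intro measurable_on_S cont_f_sphere) auto
    show "continuous_on {0..R} (\<lambda>r. indicator S w *\<^sub>R f (p + r *\<^sub>R w))" for w
    proof (cases "w \<in> S")
      case True
      have "continuous_on {0..R} (\<lambda>r. f (p + r *\<^sub>R w))"
        by (rule continuous_on_compose2[OF contf]) (use point_U True in \<open>auto intro!: continuous_intros\<close>)
      then show ?thesis using True by simp
    qed simp
    show "norm (indicator S w *\<^sub>R f (p + r *\<^sub>R w)) \<le> C" if "r \<in> {0..R}" for r w
      using that C by (auto split: split_indicator)
  qed
qed

text \<open>
  The chain rule along a curve that stays in \<open>U\<close>; then only directions in the span of \<open>bs\<close>
  matter, and the derivative of the composition is two-sided.
\<close>

lemma curve_derivative:
  assumes "(\<gamma> has_vector_derivative \<gamma>') (at t)" "open I" "t \<in> I" "\<And>s. s \<in> I \<Longrightarrow> \<gamma> s \<in> U"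
  shows "((\<lambda>s. f (\<gamma> s)) has_vector_derivative D (\<gamma> t) \<gamma>') (at t)"
proof -
  have "(f has_derivative D (\<gamma> t)) (at (\<gamma> t) within \<gamma> ` I)"
    using assms by (intro has_derivative_subset[OF deriv_f]) auto
  then have "(f \<circ> \<gamma> has_vector_derivative D (\<gamma> t) \<gamma>') (at t within I)"
    by (rule vector_derivative_diff_chain_within[OF has_vector_derivative_at_within[OF assms(1)]])
  then show ?thesis using at_within_open[OF assms(3,2)] by (simp add: o_def)
qed

lemma spherical_mean_derivative:
  assumes r: "r \<in> {0<..<R}"
  shows "(spherical_mean has_vector_derivative (\<integral>w. indicator S w *\<^sub>R D (p + r *\<^sub>R w) w \<partial>\<sigma>)) (at r)"
proof -
  obtain C where "bounds_on_ball C" using ex_bounds_on_ball by blast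
  note C = bounds_on_ballD[OF this]
  show ?thesis
    unfolding spherical_mean_def
  proof (rule has_vector_derivative_integral[OF finite_\<sigma> r])
    show "integrable \<sigma> (\<lambda>w. indicator S w *\<^sub>R f (p + t *\<^sub>R w))" if "t \<in> {0<..<R}" for t
      using that C(2) by (intro integrable_on_S[where C = C] cont_f_sphere) auto
    show "(\<lambda>w. indicator S w *\<^sub>R D (p + r *\<^sub>R w) w) \<in> borel_measurable \<sigma>"
      using r by (intro measurable_on_S cont_radial_sphere) auto
    show "norm (indicator S w *\<^sub>R D (p + t *\<^sub>R w) w) \<le> C" if "t \<in> {0<..<R}" for t w
      using that C by (auto split: split_indicator)
    show "((\<lambda>t. indicator S w *\<^sub>R f (p + t *\<^sub>R w)) has_vector_derivative indicator S w *\<^sub>R D (p + t *\<^sub>R w) w) (at t)"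
      if t: "t \<in> {0<..<R}" for t w
    proof (cases "w \<in> S")
      case True
      have "((\<lambda>t. p + t *\<^sub>R w) has_vector_derivative w) (at t)"
        by (auto intro!: derivative_eq_intros)
      then have "((\<lambda>t. f (p + t *\<^sub>R w)) has_vector_derivative D (p + t *\<^sub>R w) w) (at t)"
        by (rule curve_derivative[where I = "{0<..<R}"]) (use t point_U True in auto)
      then show ?thesis using True by simp
    qed simp
  qed
qed

text \<open>
  The trace of this matrix is the derivative of the spherical mean at \<open>r\<close>, and its antisymmetric
  part consists, up to a factor, of the integrals of angular derivatives.
\<close>

definition moment :: "real \<Rightarrow> nat \<Rightarrow> nat \<Rightarrow> 'a" where
  "moment r i j = (\<integral>w. indicator S w *\<^sub>R ((w \<bullet> bs ! i) *\<^sub>R D (p + r *\<^sub>R w) (bs ! j)) \<partial>\<sigma>)"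

lemma integrable_moment:
  assumes "0 \<le> r" "r \<le> R" "i \<le> m" "j \<le> m"
  shows "integrable \<sigma> (\<lambda>w. indicator S w *\<^sub>R ((w \<bullet> bs ! i) *\<^sub>R D (p + r *\<^sub>R w) (bs ! j)))"
proof -
  obtain C where "bounds_on_ball C" using ex_bounds_on_ball by blast
  note C = bounds_on_ballD[OF this]
  show ?thesis
  proof (rule integrable_on_S)
    show "continuous_on S (\<lambda>w. (w \<bullet> bs ! i) *\<^sub>R D (p + r *\<^sub>R w) (bs ! j))"
      using assms cont_D_sphere by (intro continuous_intros) auto
    show "norm ((w \<bullet> bs ! i) *\<^sub>R D (p + r *\<^sub>R w) (bs ! j)) \<le> 1 * C" if "w \<in> S" for w
      unfolding norm_scaleR using that C assms coord_bound[OF norm_S] by (intro mult_mono) auto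
  qed
qed

text \<open>
  The integral of \<open>f (p + r \<rho>\<^sub>t w)\<close> does not depend on \<open>t\<close> when \<open>\<rho>\<^sub>t\<close> is the rotation by \<open>t\<close> in
  the plane of \<open>bs ! i, bs ! j\<close>. Its derivative at \<open>t = 0\<close> is \<open>r\<close> times the difference of the
  two moments.
\<close>

lemma moment_symmetric_less:
  assumes r: "r \<in> {0<..<R}" and ij: "i < j" "j \<le> m"
  shows "moment r i j = moment r j i"
proof -
  obtain C where "bounds_on_ball C" using ex_bounds_on_ball by blast
  note C = bounds_on_ballD[OF this]
  have o: "bs ! i \<bullet> bs ! i = 1" "bs ! j \<bullet> bs ! j = 1" "bs ! i \<bullet> bs ! j = 0"
    using ij orthonormal_familyD[OF on] by auto
  let ?\<rho> = "plane_rotation (bs ! i) (bs ! j)"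
  define G where "G w = indicator S w *\<^sub>R f (p + r *\<^sub>R w)" for w
  define L where "L w = (w \<bullet> bs ! i) *\<^sub>R D (p + r *\<^sub>R w) (bs ! j) - (w \<bullet> bs ! j) *\<^sub>R D (p + r *\<^sub>R w) (bs ! i)" for w
  have \<rho>S1: "?\<rho> t w \<in> S" if "w \<in> S" for t w
  proof -
    have "?\<rho> t w \<in> span (set bs)"
      unfolding plane_rotation_def using ij by (intro span_add span_mul bs_span span_S[OF that]) auto
    then show ?thesis by (simp add: S_def norm_plane_rotation[OF o] norm_S[OF that])
  qed
  have \<rho>S: "?\<rho> t w \<in> S \<longleftrightarrow> w \<in> S" for t w
    using \<rho>S1 plane_rotation_inverse[OF o] by metis
  have contL: "continuous_on S L"
    unfolding L_def using r ij cont_D_sphere by (intro continuous_intros) auto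
  have boundL: "norm (L w) \<le> 2 * C" if "w \<in> S" for w
  proof -
    have "norm (L w) \<le> norm ((w \<bullet> bs ! i) *\<^sub>R D (p + r *\<^sub>R w) (bs ! j)) + norm ((w \<bullet> bs ! j) *\<^sub>R D (p + r *\<^sub>R w) (bs ! i))"
      unfolding L_def by (rule norm_triangle_ineq4)
    also have "\<dots> \<le> 1 * C + 1 * C"
      unfolding norm_scaleR using that C r ij coord_bound[OF norm_S] by (intro add_mono mult_mono) auto
    finally show ?thesis by simp
  qed
  have measG: "G \<in> borel_measurable borel"
    unfolding G_def using r by (intro borel_measurable_continuous_on_indicator borel_S cont_f_sphere) auto
  have "((\<lambda>t. \<integral>w. G (?\<rho> t w) \<partial>\<sigma>) has_vector_derivative
      (\<integral>w. indicator S w *\<^sub>R (r *\<^sub>R L (?\<rho> 0 w)) \<partial>\<sigma>)) (at 0)"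
  proof (rule has_vector_derivative_integral[OF finite_\<sigma>, where a = "-1" and b = 1 and C = "r * (2 * C)"])
    fix t :: real
    interpret finite_measure \<sigma> by (rule finite_\<sigma>)
    have "(\<lambda>w. G (?\<rho> t w)) \<in> borel_measurable borel"
      by (rule measurable_compose[OF borel_measurable_plane_rotation measG])
    then show "integrable \<sigma> (\<lambda>w. G (?\<rho> t w))"
      by (intro integrable_const_bound[of _ C])
         (use C r \<rho>S in \<open>auto simp: G_def sets_\<sigma> cong: measurable_cong_sets split: split_indicator\<close>)
    fix w
    show "norm (indicator S w *\<^sub>R (r *\<^sub>R L (?\<rho> t w))) \<le> r * (2 * C)"
      using boundL[OF \<rho>S1, of w t] r C(1) by (auto split: split_indicator intro!: mult_left_mono)
    show "((\<lambda>t. G (?\<rho> t w)) has_vector_derivative indicator S w *\<^sub>R (r *\<^sub>R L (?\<rho> t w))) (at t)"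
    proof (cases "w \<in> S")
      case True
      let ?y = "?\<rho> t w"
      have yU: "p + r *\<^sub>R ?y \<in> U" using point_U[OF \<rho>S1[OF True]] r by auto
      have "((\<lambda>t. p + r *\<^sub>R ?\<rho> t w) has_vector_derivative
          0 + r *\<^sub>R ((?y \<bullet> bs ! i) *\<^sub>R (bs ! j) - (?y \<bullet> bs ! j) *\<^sub>R (bs ! i))) (at t)"
        by (intro has_vector_derivative_add has_vector_derivative_const
            bounded_linear.has_vector_derivative[OF bounded_linear_scaleR_right]
            has_vector_derivative_plane_rotation[OF o])
      then have "((\<lambda>t. f (p + r *\<^sub>R ?\<rho> t w)) has_vector_derivative
          D (p + r *\<^sub>R ?y) (0 + r *\<^sub>R ((?y \<bullet> bs ! i) *\<^sub>R (bs ! j) - (?y \<bullet> bs ! j) *\<^sub>R (bs ! i)))) (at t)"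
        by (rule curve_derivative[where I = UNIV]) (use point_U[OF \<rho>S1[OF True]] r in auto)
      moreover note linear_scale[OF linear_D[OF yU]] linear_diff[OF linear_D[OF yU]]
      ultimately show ?thesis using True by (simp add: G_def \<rho>S L_def)
    qed (simp add: G_def \<rho>S)
  next
    show "(\<lambda>w. indicator S w *\<^sub>R (r *\<^sub>R L (?\<rho> 0 w))) \<in> borel_measurable \<sigma>"
      using contL by (intro measurable_on_S continuous_intros) (simp add: plane_rotation_def)
  qed simp
  moreover have "(\<integral>w. G (?\<rho> t w) \<partial>\<sigma>) = (\<integral>w. G w \<partial>\<sigma>)" for t
    by (rule integral_sphere_surface_rotation[OF len on ij measG])
  ultimately have "((\<lambda>t::real. \<integral>w. G w \<partial>\<sigma>) has_vector_derivative
      (\<integral>w. indicator S w *\<^sub>R (r *\<^sub>R L (?\<rho> 0 w)) \<partial>\<sigma>)) (at 0)"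
    by simp
  then have "(\<integral>w. indicator S w *\<^sub>R (r *\<^sub>R L (?\<rho> 0 w)) \<partial>\<sigma>) = 0"
    using vector_derivative_unique_at has_vector_derivative_const by blast
  moreover have "(\<integral>w. indicator S w *\<^sub>R (r *\<^sub>R L (?\<rho> 0 w)) \<partial>\<sigma>) = r *\<^sub>R (moment r i j - moment r j i)"
  proof -
    have "(\<integral>w. indicator S w *\<^sub>R (r *\<^sub>R L (?\<rho> 0 w)) \<partial>\<sigma>) =
      (\<integral>w. r *\<^sub>R (indicator S w *\<^sub>R ((w \<bullet> bs ! i) *\<^sub>R D (p + r *\<^sub>R w) (bs ! j)) -
          indicator S w *\<^sub>R ((w \<bullet> bs ! j) *\<^sub>R D (p + r *\<^sub>R w) (bs ! i))) \<partial>\<sigma>)"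
      by (intro Bochner_Integration.integral_cong) (auto simp: L_def plane_rotation_def split: split_indicator)
    also have "\<dots> = r *\<^sub>R (moment r i j - moment r j i)"
      unfolding moment_def using integrable_moment r ij
      by (simp add: Bochner_Integration.integral_diff)
    finally show ?thesis .
  qed
  ultimately show ?thesis using r by simp
qed

lemma moment_symmetric:
  assumes r: "r \<in> {0<..<R}" and ij: "i \<le> m" "j \<le> m"
  shows "moment r i j = moment r j i"
  using moment_symmetric_less[OF r] ij by (metis linorder_neqE_nat)

text \<open>
  The Clifford conjugate of \<open>bs ! i\<close>, which is also its inverse.
\<close>

definition conj_basis :: "nat \<Rightarrow> 'a" where "conj_basis i = (if i = 0 then 1 else - (bs ! i))"

lemma conj_same: "i \<le> m \<Longrightarrow> conj_basis i * bs ! i = 1"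
  using square[of i] unit0 by (auto simp: conj_basis_def)

lemma conj_antisym: "i \<le> m \<Longrightarrow> j \<le> m \<Longrightarrow> i \<noteq> j \<Longrightarrow> conj_basis i * bs ! j = - (conj_basis j * bs ! i)"
  using anticomm[of i j] unit0 by (auto simp: conj_basis_def)

text \<open>
  With \<open>c\<^sub>i\<close> for the conjugate of \<open>bs ! i\<close>, the Dirac equation multiplied from the left by
  \<open>\<Sum>\<^sub>i w\<^sub>i c\<^sub>i\<close> and integrated says that the sum of \<open>c\<^sub>i (bs ! j)\<close> times the moments vanishes. Off the
  diagonal this pairs an antisymmetric with a symmetric matrix and contributes nothing; on the
  diagonal the coefficients are \<open>1\<close>.
\<close>

lemma radial_integral_zero:
  assumes r: "r \<in> {0<..<R}"
  shows "(\<integral>w. indicator S w *\<^sub>R D (p + r *\<^sub>R w) w \<partial>\<sigma>) = 0"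
proof -
  let ?I = "moment r"
  let ?g = "\<lambda>i j w. indicator S w *\<^sub>R ((w \<bullet> bs ! i) *\<^sub>R D (p + r *\<^sub>R w) (bs ! j))"
  have int: "integrable \<sigma> (?g i j)" if "i \<le> m" "j \<le> m" for i j
    using integrable_moment that r by simp
  have int': "integrable \<sigma> (\<lambda>w. conj_basis i * bs ! j * ?g i j w)" if "i \<le> m" "j \<le> m" for i j
    by (rule integrable_bounded_linear[OF bounded_linear_left_mult int[OF that]])
  have "(\<Sum>i\<le>m. \<Sum>j\<le>m. conj_basis i * bs ! j * ?I i j) = (\<Sum>i\<le>m. \<Sum>j\<le>m. \<integral>w. conj_basis i * bs ! j * ?g i j w \<partial>\<sigma>)"
    unfolding moment_def using int
    by (intro sum.cong integral_bounded_linear[OF bounded_linear_left_mult, symmetric]) auto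
  also have "\<dots> = (\<integral>w. (\<Sum>i\<le>m. \<Sum>j\<le>m. conj_basis i * bs ! j * ?g i j w) \<partial>\<sigma>)"
  proof -
    have inner: "(\<integral>w. (\<Sum>j\<le>m. conj_basis i * bs ! j * ?g i j w) \<partial>\<sigma>) = (\<Sum>j\<le>m. \<integral>w. conj_basis i * bs ! j * ?g i j w \<partial>\<sigma>)"
      if "i \<le> m" for i
      by (rule Bochner_Integration.integral_sum, rule int'[OF that]) simp
    have outer: "(\<integral>w. (\<Sum>i\<le>m. \<Sum>j\<le>m. conj_basis i * bs ! j * ?g i j w) \<partial>\<sigma>) =
        (\<Sum>i\<le>m. \<integral>w. (\<Sum>j\<le>m. conj_basis i * bs ! j * ?g i j w) \<partial>\<sigma>)"
      by (rule Bochner_Integration.integral_sum, rule Bochner_Integration.integrable_sum, rule int') simp_all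
    show ?thesis unfolding outer by (rule sum.cong[OF refl]) (simp only: inner atMost_iff)
  qed
  also have "\<dots> = (\<integral>w. 0 \<partial>\<sigma>)"
  proof (rule Bochner_Integration.integral_cong)
    fix w
    show "(\<Sum>i\<le>m. \<Sum>j\<le>m. conj_basis i * bs ! j * ?g i j w) = 0"
    proof (cases "w \<in> S")
      case True
      have "(\<Sum>i\<le>m. \<Sum>j\<le>m. conj_basis i * bs ! j * ?g i j w) =
          (\<Sum>i\<le>m. (w \<bullet> bs ! i) *\<^sub>R (conj_basis i * (\<Sum>j\<le>m. bs ! j * D (p + r *\<^sub>R w) (bs ! j))))"
        using True by (simp add: sum_distrib_left scaleR_sum_right mult.assoc)
      also have "\<dots> = 0" using dirac[OF point_U[OF True]] r by simp
      finally show ?thesis .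
    qed simp
  qed simp
  finally have total: "(\<Sum>i\<le>m. \<Sum>j\<le>m. conj_basis i * bs ! j * ?I i j) = 0" by simp
  define M where "M i j = (if i = j then 0 else conj_basis i * bs ! j * ?I i j)" for i j
  have anti: "M i j = - M j i" if "i \<le> m" "j \<le> m" for i j
    using that conj_antisym[of i j] moment_symmetric[OF r that] by (auto simp: M_def)
  have "(\<Sum>i\<le>m. \<Sum>j\<le>m. M i j) = (\<Sum>i\<le>m. \<Sum>j\<le>m. - M j i)"
    by (rule sum.cong[OF refl], rule sum.cong[OF refl], rule anti) simp_all
  also have "\<dots> = - (\<Sum>i\<le>m. \<Sum>j\<le>m. M i j)"
    unfolding sum_negf by (subst sum.swap) simp
  finally have "2 *\<^sub>R (\<Sum>i\<le>m. \<Sum>j\<le>m. M i j) = 0"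
    unfolding scaleR_2 by (simp only: eq_neg_iff_add_eq_0)
  then have M0: "(\<Sum>i\<le>m. \<Sum>j\<le>m. M i j) = 0" by simp
  have "conj_basis i * bs ! j * ?I i j = M i j + (if i = j then ?I i j else 0)" if "i \<le> m" for i j
    using conj_same[OF that] by (auto simp: M_def)
  then have "(\<Sum>i\<le>m. \<Sum>j\<le>m. conj_basis i * bs ! j * ?I i j) =
      (\<Sum>i\<le>m. \<Sum>j\<le>m. M i j + (if i = j then ?I i j else 0))"
    by (intro sum.cong) auto
  also have "\<dots> = (\<Sum>i\<le>m. ?I i i)"
    using M0 by (simp add: sum.distrib)
  finally have "(\<Sum>i\<le>m. ?I i i) = 0" using total by simp
  moreover have "(\<integral>w. indicator S w *\<^sub>R D (p + r *\<^sub>R w) w \<partial>\<sigma>) = (\<integral>w. (\<Sum>i\<le>m. ?g i i w) \<partial>\<sigma>)"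
  proof (rule Bochner_Integration.integral_cong)
    fix w
    show "indicator S w *\<^sub>R D (p + r *\<^sub>R w) w = (\<Sum>i\<le>m. ?g i i w)"
      using D_expand[OF point_U span_S, of w r w] r by (auto split: split_indicator)
  qed simp
  ultimately show ?thesis
    unfolding moment_def using int by (simp add: Bochner_Integration.integral_sum)
qed

text \<open>
  The spherical mean is constant because its derivative vanishes on \<open>(0, R)\<close>. At \<open>r = 0\<close> rotations
  leave \<open>p + r w\<close> in place and say nothing about the moments, and at \<open>r = R\<close> the radii on one side
  may leave \<open>U\<close>, so both end points are covered by continuity.
\<close>

theorem spherical_mean_value:
  "(\<integral>w. indicator S w *\<^sub>R f (p + R *\<^sub>R w) \<partial>\<sigma>) = sphere_area m *\<^sub>R f p"
proof -
  have "spherical_mean R = spherical_mean 0"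
  proof (rule has_derivative_zero_unique_strong_interval[where a = 0 and b = R and k = "{0, R}"])
    show "(spherical_mean has_derivative (\<lambda>h. 0)) (at r within {0..R})" if "r \<in> {0..R} - {0, R}" for r
      using spherical_mean_derivative[of r] radial_integral_zero[of r] that
      by (auto simp: has_vector_derivative_def intro: has_derivative_at_withinI)
  qed (use R_pos continuous_on_spherical_mean in auto)
  also have "spherical_mean 0 = measure \<sigma> S *\<^sub>R f p"
  proof -
    interpret finite_measure \<sigma> by (rule finite_\<sigma>)
    have "integrable \<sigma> (indicator S :: 'a \<Rightarrow> real)"
      by (simp add: integrable_indicator_iff sets_\<sigma> space_\<sigma> emeasure_eq_measure)
    then show ?thesis by (simp add: spherical_mean_def space_\<sigma>)
  qed
  also have "measure \<sigma> S = sphere_area m"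
    using emeasure_sphere_surface[OF len m_pos on borel_S] m_pos
    by (simp add: measure_def sphere_area_eq S_def)
  finally show ?thesis by (simp add: spherical_mean_def)
qed

end

section \<open>Slice bases of a hypercomplex basis\<close>

lemma imag_units_square:
  assumes "x \<in> imag_units c"
  shows "x * x = -1"
proof -
  have "c x = - x" using assms by (simp add: imag_units_def trace_of_def add_eq_0_iff)
  then have "x * (- x) = 1" using assms by (simp add: imag_units_def norm_of_def)
  then show ?thesis by (metis mult_minus_right minus_equation_iff)
qed

text \<open>
  Both sides are bilinear, so it is enough to compare them on the basis. In particular a unit vector
  of the span squares to \<open>-1\<close> and orthogonal vectors anticommute, whatever orthonormal system is
  chosen; this is why a slice basis is again of hypercomplex type.
\<close>

lemma hypercomplex_anticommutator:
  fixes v :: "nat \<Rightarrow> 'a::{euclidean_space, real_algebra_1}"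
  assumes basis: "hypercomplex_basis c V n v" and on: "orthonormal_family n v"
    and x: "x \<in> span (v ` {1..n})" and y: "y \<in> span (v ` {1..n})"
  shows "x * y + y * x = (- 2 * (x \<bullet> y)) *\<^sub>R 1"
proof -
  have vv: "v s * v u + v u * v s = (- 2 * (v s \<bullet> v u)) *\<^sub>R 1" if "s \<in> {1..n}" "u \<in> {1..n}" for s u
  proof (cases "s = u")
    case True
    have "v s * v s = -1"
      using basis that(1) by (intro imag_units_square) (auto simp: hypercomplex_basis_def)
    moreover have "v s \<bullet> v s = 1" using orthonormal_familyD[OF on, of s s] that by simp
    moreover have "(- 2 :: real) *\<^sub>R (1 :: 'a) = -1 + -1"
      by (simp only: scaleR_minus_left scaleR_2) simp
    ultimately show ?thesis using True by simp
  next
    case False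
    have "v s * v u = - (v u * v s)" using basis that False unfolding hypercomplex_basis_def by blast
    moreover have "v s \<bullet> v u = 0" using orthonormal_familyD[OF on, of s u] that False by simp
    ultimately show ?thesis by simp
  qed
  have vy: "v s * y + y * v s = (- 2 * (v s \<bullet> y)) *\<^sub>R 1" if s: "s \<in> {1..n}" for s
  proof (rule linear_eq_on[where f = "\<lambda>z. v s * z + z * v s" and g = "\<lambda>z. (- 2 * (v s \<bullet> z)) *\<^sub>R 1"])
    show "linear (\<lambda>z. v s * z + z * v s)" by (rule linearI) (simp_all add: distrib_left distrib_right scaleR_add_right)
    show "linear (\<lambda>z. (- 2 * (v s \<bullet> z)) *\<^sub>R (1 :: 'a))"
      by (rule linearI) (simp_all add: inner_add_right algebra_simps)
  qed (use y vv[OF s] in auto)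
  show ?thesis
  proof (rule linear_eq_on[where f = "\<lambda>z. z * y + y * z" and g = "\<lambda>z. (- 2 * (z \<bullet> y)) *\<^sub>R 1"])
    show "linear (\<lambda>z. z * y + y * z)" by (rule linearI) (simp_all add: distrib_left distrib_right scaleR_add_right)
    show "linear (\<lambda>z. (- 2 * (z \<bullet> y)) *\<^sub>R (1 :: 'a))"
      by (rule linearI) (simp_all add: inner_add_left algebra_simps)
  qed (use x vy in auto)
qed

lemma inner_zero_span:
  assumes "x \<in> span A" "y \<in> span B" "\<And>a b. a \<in> A \<Longrightarrow> b \<in> B \<Longrightarrow> a \<bullet> b = 0"
  shows "x \<bullet> y = 0"
proof -
  have "orthogonal b x" if "b \<in> B" for b
    by (rule orthogonal_to_span[OF assms(1)]) (use assms(3) that in \<open>auto simp: orthogonal_def inner_commute\<close>)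
  then have "orthogonal x y"
    using orthogonal_to_span[OF assms(2)] orthogonal_commute by blast
  then show ?thesis by (simp add: orthogonal_def)
qed

lemma slice_basis_structure:
  assumes steps: "list_of_steps n \<tau> T" and J: "J \<in> torus v T"
  shows "length (slice_basis v T J) = Suc (T ! 0 + \<tau>)"
    and "i \<le> T ! 0 \<Longrightarrow> slice_basis v T J ! i = v i"
    and "h < \<tau> \<Longrightarrow> slice_basis v T J ! (T ! 0 + 1 + h) = J ! h"
    and "h < \<tau> \<Longrightarrow> J ! h \<in> span (v ` {T ! h + 1..T ! (h + 1)})"
    and "h < \<tau> \<Longrightarrow> norm (J ! h) = 1"
proof -
  have l: "length J = \<tau>" using steps J by (auto simp: list_of_steps_def torus_def)
  show "length (slice_basis v T J) = Suc (T ! 0 + \<tau>)" by (simp add: slice_basis_def l)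
  show "i \<le> T ! 0 \<Longrightarrow> slice_basis v T J ! i = v i"
    by (simp add: slice_basis_def nth_append del: upt_Suc)
  show "h < \<tau> \<Longrightarrow> slice_basis v T J ! (T ! 0 + 1 + h) = J ! h"
    by (simp add: slice_basis_def nth_append del: upt_Suc)
  show "h < \<tau> \<Longrightarrow> J ! h \<in> span (v ` {T ! h + 1..T ! (h + 1)})" "h < \<tau> \<Longrightarrow> norm (J ! h) = 1"
    using J l by (auto simp: torus_def unit_sphere_span_def)
qed

lemma steps_mono:
  assumes "list_of_steps n \<tau> T" "h \<le> k" "k \<le> \<tau>"
  shows "T ! h \<le> T ! k" 
  using assms by (cases "h = k") (auto simp: list_of_steps_def sorted_wrt_iff_nth_less less_imp_le)

text \<open>
  The indices of those \<open>v\<^sub>s\<close> that can occur in the \<open>i\<close>-th slice basis vector: a single one for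
  \<open>v\<^sub>0, \<dots>, v\<^sub>t\<^sub>0\<close>, a whole step for the vectors of the torus point. The \<open>i\<close>-th vector with
  \<open>i > t\<^sub>0\<close> is at position \<open>i - t\<^sub>0 - 1\<close> of the list \<open>J\<close>.
\<close>

definition slice_block :: "nat list \<Rightarrow> nat \<Rightarrow> nat set" where
  "slice_block T i = (if i \<le> T ! 0 then {i} else {T ! (i - T ! 0 - 1) + 1..T ! (i - T ! 0)})"

lemma slice_block_subset:
  assumes steps: "list_of_steps n \<tau> T" and i: "i \<le> T ! 0 + \<tau>"
  shows "slice_block T i \<subseteq> {0..n}" and "i \<noteq> 0 \<Longrightarrow> slice_block T i \<subseteq> {1..n}"
proof -
  have "T ! k \<le> n" if "k \<le> \<tau>" for k
    using steps_mono[OF steps that] steps by (simp add: list_of_steps_def)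
  from this[of 0] this[of "i - T ! 0"] i
  show "slice_block T i \<subseteq> {0..n}" "i \<noteq> 0 \<Longrightarrow> slice_block T i \<subseteq> {1..n}"
    by (auto simp: slice_block_def)
qed

lemma slice_basis_block:
  assumes steps: "list_of_steps n \<tau> T" and J: "J \<in> torus v T" and i: "i \<le> T ! 0 + \<tau>"
  shows "slice_basis v T J ! i \<in> span (v ` slice_block T i)"
proof (cases "i \<le> T ! 0")
  case True
  then show ?thesis using slice_basis_structure(2)[OF steps J True]
    by (auto simp: slice_block_def intro: span_base)
next
  case False
  define h where "h = i - T ! 0 - 1"
  have h: "h < \<tau>" "i = T ! 0 + 1 + h" "i - T ! 0 = h + 1" using False i by (auto simp: h_def)
  have "slice_block T i = {T ! h + 1..T ! (h + 1)}" using False h by (simp add: slice_block_def)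
  then show ?thesis
    using slice_basis_structure(3,4)[OF steps J h(1)] h(2) by simp
qed

lemma slice_block_less:
  assumes steps: "list_of_steps n \<tau> T" and ij: "i < j" "j \<le> T ! 0 + \<tau>"
    and ab: "a \<in> slice_block T i" "b \<in> slice_block T j"
  shows "a < b"
proof -
  consider "j \<le> T ! 0" | "i \<le> T ! 0" "\<not> j \<le> T ! 0" | "\<not> i \<le> T ! 0" "\<not> j \<le> T ! 0" using ij by linarith
  then show ?thesis
  proof cases
    case 1
    then show ?thesis using ab ij by (auto simp: slice_block_def)
  next
    case 2
    have "T ! 0 \<le> T ! (j - T ! 0 - 1)" using ij 2 by (intro steps_mono[OF steps]) auto
    then show ?thesis using ab 2 by (auto simp: slice_block_def)
  next
    case 3
    have "T ! (i - T ! 0) \<le> T ! (j - T ! 0 - 1)" using ij 3 by (intro steps_mono[OF steps]) auto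
    then show ?thesis using ab 3 by (auto simp: slice_block_def)
  qed
qed

lemma slice_basis_span:
  assumes steps: "list_of_steps n \<tau> T" and J: "J \<in> torus v T" and i: "i \<le> T ! 0 + \<tau>"
  shows "slice_basis v T J ! i \<in> span (v ` {0..n})"
    and "i \<noteq> 0 \<Longrightarrow> slice_basis v T J ! i \<in> span (v ` {1..n})"
  using slice_basis_block[OF assms] span_mono[OF image_mono[OF slice_block_subset(1)[OF steps i]], of v]
    span_mono[OF image_mono[OF slice_block_subset(2)[OF steps i]], of v] by auto

text \<open>
  Different vectors of the slice basis involve disjoint blocks of the orthonormal family.
\<close>

lemma slice_basis_orthonormal:
  assumes steps: "list_of_steps n \<tau> T" and J: "J \<in> torus v T" and on: "orthonormal_family n v"
  shows "orthonormal_family (T ! 0 + \<tau>) ((!) (slice_basis v T J))"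
proof -
  let ?b = "slice_basis v T J"
  have T0: "T ! 0 \<le> n" using steps_mono[OF steps, of 0 \<tau>] steps by (simp add: list_of_steps_def)
  have unit: "?b ! i \<bullet> ?b ! i = 1" if i: "i \<le> T ! 0 + \<tau>" for i
  proof (cases "i \<le> T ! 0")
    case True
    then show ?thesis using slice_basis_structure(2)[OF steps J True] orthonormal_familyD[OF on, of i i] T0 by simp
  next
    case False
    define h where "h = i - T ! 0 - 1"
    have h: "h < \<tau>" "i = T ! 0 + 1 + h" using False i by (auto simp: h_def)
    have "norm (?b ! i) = 1"
      unfolding h(2) slice_basis_structure(3)[OF steps J h(1)] by (rule slice_basis_structure(5)[OF steps J h(1)])
    then show ?thesis by (simp add: dot_square_norm)
  qed
  have orth: "?b ! i \<bullet> ?b ! j = 0" if ij: "i < j" "j \<le> T ! 0 + \<tau>" for i j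
  proof -
    show ?thesis
    proof (rule inner_zero_span)
      show "?b ! i \<in> span (v ` slice_block T i)" "?b ! j \<in> span (v ` slice_block T j)"
        using ij by (auto intro: slice_basis_block[OF steps J])
      fix a b assume "a \<in> v ` slice_block T i" "b \<in> v ` slice_block T j"
      then obtain k l where kl: "k \<in> slice_block T i" "l \<in> slice_block T j" "a = v k" "b = v l" by blast
      have "k \<le> n" "l \<le> n"
        using kl slice_block_subset(1)[OF steps, of i] slice_block_subset(1)[OF steps, of j] ij by auto
      moreover have "k < l" by (rule slice_block_less[OF steps ij kl(1,2)])
      ultimately show "a \<bullet> b = 0" using orthonormal_familyD[OF on, of k l] kl by simp
    qed
  qed
  show ?thesis
    unfolding orthonormal_family_def
  proof (intro allI impI)
    fix i j assume ij: "i \<le> T ! 0 + \<tau>" "j \<le> T ! 0 + \<tau>"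
    show "?b ! i \<bullet> ?b ! j = (if i = j then 1 else 0)"
      using ij unit[of i] orth[of i j] orth[of j i] by (cases i j rule: linorder_cases) (auto simp: inner_commute)
  qed
qed

text \<open>
  The partial derivative is taken along a whole line, the derivative \<open>D\<close> within \<open>U\<close>. They agree
  because \<open>U\<close>, being relatively open, contains a segment of the line around \<open>x\<close>.
\<close>

lemma partial_deriv_eq:
  assumes op: "openin (top_of_set W) U" and W: "subspace W" and x: "x \<in> U" and b: "b \<in> W"
    and D: "(f has_derivative D) (at x within U)"
  shows "partial_deriv b f x = D b"
proof -
  have xW: "U \<subseteq> W" using op openin_imp_subset by blast
  obtain O' where O': "open O'" "U = W \<inter> O'" using op by (auto simp: openin_open)
  let ?\<gamma> = "\<lambda>h::real. x + h *\<^sub>R b"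
  define I where "I = ?\<gamma> -` O'"
  have I: "open I" unfolding I_def by (rule open_vimage[OF O'(1)]) (intro continuous_intros)
  have 0: "0 \<in> I" using x O' by (simp add: I_def)
  have sub: "?\<gamma> ` I \<subseteq> U"
    using x xW W b O' by (auto simp: I_def intro!: subspace_add subspace_scale)
  have "(?\<gamma> has_vector_derivative b) (at 0 within I)"
    by (auto intro!: derivative_eq_intros)
  moreover have "(f has_derivative D) (at (?\<gamma> 0) within ?\<gamma> ` I)"
    using has_derivative_subset[OF D sub] by simp
  ultimately have "(f \<circ> ?\<gamma> has_vector_derivative D b) (at 0 within I)"
    by (rule vector_derivative_diff_chain_within)
  then have "((\<lambda>h. f (?\<gamma> h)) has_vector_derivative D b) (at 0)"
    using at_within_open[OF 0 I] by (simp add: o_def)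
  then show ?thesis unfolding partial_deriv_def by (rule vector_derivative_at)
qed

section \<open>The mean value property of T-regular functions\<close>

theorem proposition4p22:
  fixes c :: "'a::{euclidean_space, real_algebra_1} \<Rightarrow> 'a"
    and V \<Omega> :: "'a set"
    and v :: "nat \<Rightarrow> 'a"
    and n d \<tau> :: nat
    and T :: "nat list"
    and f :: "'a \<Rightarrow> 'a"
    and J :: "'a list"
    and p :: 'a
    and R :: real
  assumes "star_involution c"
    and "imag_units c \<noteq> {}"
    and "hypercomplex_subspace c V"
    and "hypercomplex_basis c V n v"
    and "n \<le> d"
    and "ordered_basis d v UNIV"
    and "orthonormal_family d v"
    and "list_of_steps n \<tau> T"
    and "domain_in V \<Omega>"
    and "T_regular v T \<Omega> f"
    and "J \<in> torus v T"
    and "p \<in> \<Omega> \<inter> slice v T J"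
    and "R > 0"
    and "(V \<inter> cball p R) \<inter> slice v T J \<subseteq> \<Omega> \<inter> slice v T J"
  shows "f p = (1 / sphere_area (T ! 0 + \<tau>)) *\<^sub>R
    (LINT w:{w \<in> slice v T J. norm w = 1}|sphere_surface (slice_basis v T J). f (p + R *\<^sub>R w))"
proof -
  note steps = assms(8) and J = assms(11)
  define bs where "bs = slice_basis v T J"
  define m where "m = T ! 0 + \<tau>"
  define U where "U = \<Omega> \<inter> slice v T J"
  have slice: "slice v T J = span (set bs)" by (simp add: slice_def bs_def)
  have onn: "orthonormal_family n v" using assms(5,7) by (auto simp: orthonormal_family_def)
  have n1: "n \<ge> 1" and v0: "v 0 = 1" and V: "V = span (v ` {0..n})"
    using assms(4) by (auto simp: hypercomplex_basis_def ordered_basis_def)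
  have len: "length bs = Suc m" using slice_basis_structure(1)[OF steps J] by (simp add: bs_def m_def)
  \<comment> \<open>For \<open>\<tau> = 0\<close> the only step is \<open>n \<ge> 1\<close>.\<close>
  have m1: "1 \<le> m" using steps n1 by (cases "\<tau> = 0") (auto simp: list_of_steps_def m_def)
  have on: "orthonormal_family m ((!) bs)"
    unfolding bs_def m_def by (rule slice_basis_orthonormal[OF steps J onn])
  have b0: "bs ! 0 = 1" using slice_basis_structure(2)[OF steps J, of 0] v0 by (simp add: bs_def)
  have bspan: "bs ! i \<in> span (v ` {1..n})" if "i \<in> {1..m}" for i
    using that slice_basis_span(2)[OF steps J, of i] by (simp add: bs_def m_def)
  have anti: "bs ! i * bs ! j + bs ! j * bs ! i = (- 2 * (bs ! i \<bullet> bs ! j)) *\<^sub>R 1" if "i \<in> {1..m}" "j \<in> {1..m}" for i j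
    using hypercomplex_anticommutator[OF assms(4) onn bspan[OF that(1)] bspan[OF that(2)]] .
  have sliceV: "slice v T J \<subseteq> V"
    unfolding slice V
  proof (rule span_minimal)
    show "set bs \<subseteq> span (v ` {0..n})"
    proof
      fix b assume "b \<in> set bs"
      then obtain i where "i \<le> m" "b = bs ! i" using len by (metis in_set_conv_nth less_Suc_eq_le)
      then show "b \<in> span (v ` {0..n})" using slice_basis_span(1)[OF steps J, of i] by (simp add: bs_def m_def)
    qed
  qed simp
  have op: "openin (top_of_set (span (set bs))) U"
  proof -
    have "openin (top_of_set V) \<Omega>" using assms(9) by (simp add: domain_in_def)
    then obtain O' where "open O'" "\<Omega> = V \<inter> O'" by (auto simp: openin_open)
    then have "U = span (set bs) \<inter> O'" using sliceV slice by (auto simp: U_def)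
    then show ?thesis using \<open>open O'\<close> by (simp add: openin_open_Int)
  qed
  have "monogenic_on bs U f" using assms(10) J by (simp add: T_regular_def bs_def U_def)
  then obtain D where D: "\<And>x. x \<in> U \<Longrightarrow> (f has_derivative D x) (at x within U)"
      "\<And>b. b \<in> span (set bs) \<Longrightarrow> continuous_on U (\<lambda>x. D x b)"
    and pd: "\<And>x. x \<in> U \<Longrightarrow> (\<Sum>b\<leftarrow>bs. b * partial_deriv b f x) = 0"
    by (auto simp: monogenic_on_def C1_on_def)
  interpret dirac_null_solution bs m U f D p R
  proof
    show "bs ! i * bs ! i = -1" if "i \<in> {1..m}" for i
    proof -
      have "2 *\<^sub>R (bs ! i * bs ! i) = 2 *\<^sub>R (-1)"
        using anti[OF that that] orthonormal_familyD[OF on, of i i] that by (simp flip: scaleR_2)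
      then show ?thesis by (rule scaleR_left_imp_eq[rotated]) simp
    qed
    show "bs ! i * bs ! j = - (bs ! j * bs ! i)" if "i \<in> {1..m}" "j \<in> {1..m}" "i \<noteq> j" for i j
      using anti[OF that(1,2)] orthonormal_familyD[OF on, of i j] that by (simp add: eq_neg_iff_add_eq_0)
    show "(\<Sum>j\<le>m. bs ! j * D x (bs ! j)) = 0" if x: "x \<in> U" for x
    proof -
      have "(\<Sum>j\<le>m. bs ! j * D x (bs ! j)) = (\<Sum>j<length bs. bs ! j * partial_deriv (bs ! j) f x)"
        unfolding len lessThan_Suc_atMost
        by (intro sum.cong refl arg_cong2[where f = "(*)"] partial_deriv_eq[OF op _ x _ D(1)[OF x], symmetric])
           (auto simp: len intro: span_base)
      also have "\<dots> = (\<Sum>b\<leftarrow>bs. b * partial_deriv b f x)"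
        by (simp add: sum_list_sum_nth atLeast0LessThan)
      finally show ?thesis using pd[OF x] by simp
    qed
    show "x \<in> U" if "x \<in> span (set bs)" "norm (x - p) \<le> R" for x
      using that assms(14) sliceV slice by (auto simp: U_def dist_norm norm_minus_commute)
  qed (use len m1 on b0 D op assms(12,13) slice in \<open>auto simp: U_def\<close>)
  have "sphere_area m > 0" using m1 by (simp add: sphere_area_eq)
  then show ?thesis
    using spherical_mean_value
    by (simp add: set_lebesgue_integral_def slice S_def flip: bs_def m_def)
qed

end
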